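(* For $r\ge0$ and real $T\ge2$ let $$S_r(T)=\sum_{1\le m\le T}\frac1m\,\psi\!\left(\frac{T}{m+r}\right),\qquad \psi(u)=u-\lfloor u\rfloor-\tfrac12 .$$ For every fixed $r\in\mathbb Q_{\ge0}$, $$\limsup_{T\to\infty}\frac{S_r(T)}{\log\log T}\ge\frac12,\qquad \liminf_{T\to\infty}\frac{S_r(T)}{\log\log T}\le-\frac12 .$$ If moreover $2r\in\mathbb Z$, then the stronger estimates $$\limsup_{T\to\infty}\frac{S_r(T)}{\log\log T}\ge\frac{e^\gamma}{2},\qquad \liminf_{T\to\infty}\frac{S_r(T)}{\log\log T}\le-\frac{e^\gamma}{2}$$ hold, where $\gamma$ is Euler's constant.
   Context: $T$ ranges over real numbers and $m$ over integers. The sawtooth $\psi$ takes the value $-1/2$ at integers. *)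

theory Defs
  imports "HOL-Analysis.Analysis"
begin

definition sawtooth :: "real \<Rightarrow> real" where
  "sawtooth u = u - of_int \<lfloor>u\<rfloor> - 1 / 2"

definition sawtooth_sum :: "real \<Rightarrow> real \<Rightarrow> real" where
  "sawtooth_sum r T = (\<Sum>m\<in>{m::int. 1 \<le> m \<and> of_int m \<le> T}. 1 / of_int m * sawtooth (T / (of_int m + r)))"

end

(* With r = a/b, the terms with m > T^(1/2) contribute only O(1): after exchanging summations this
   is Stirling's formula. For T = A n or T = A n - 1/(2b), with n running over [A^3, 2 A^3), the
   terms with b m + a dividing b A are all close to -1/2 or to 1/2 respectively, while the average
   over n of each remaining term has the same sign up to a negligible error. Hence some T with
   log log T = log log A + O(1) satisfies S_r(T) <= -D/2 + O(1), resp. S_r(T) >= D/2 - O(1), where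
   D is the sum of 1/m over m >= 1 with b m + a dividing b A. For A = y! one has
   D >= log y - O(1). If b is 1 or 2, then for A the k-th power of the product of the primes up to y
   not dividing b, D is essentially an Euler product, and exceeds c log y for every c < e^gamma
   and infinitely many y. This last fact needs only a one-sided, infinitely-often form of Mertens'
   theorem, obtained from the pole of the zeta function at 1. *)

theory Submission
  imports Defs "HOL-Computational_Algebra.Primes"
begin

section \<open>The sawtooth function\<close>

text \<open>Only bounded errors are affordable, since the main term has size log log A. This fixes
  the scales: for T between A^4 - 1 and 2 A^4 the cutoff 2 A^2 exceeds sqrt T, and A^3 values of n
  cover each period b m + a so often that the incomplete periods contribute O(1/A) to the average.
  The means of the nonresonant terms are never computed; only their sign matters. The value -1/2 at
  integers favours the negative side, and on the positive side the shift keeps the arguments away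
  from the integers. For both choices of A, log log A is about log y, so the constant is the ratio
  of D to log y. The substitution q = b m + a gives 1/m >= b/q. If 2 r is an integer, D is
  therefore, up to O(1), at least b times the sum of 1/q over all divisors q of A: the congruence of
  q and a mod b is trivial for b = 1, and for b = 2 it holds because a and A are odd. The lost Euler
  factor at 2 equals 2 = b, so e^gamma survives. Limsup and liminf need only arbitrarily large T,
  hence the infinitely-often form of Mertens' theorem suffices. Gamma enters as minus the derivative
  of the Gamma function at 1.\<close>

lemma sawtooth_add_int: "sawtooth (x + of_int k) = sawtooth x"
  by (simp add: sawtooth_def)

lemma abs_sawtooth_le: "\<bar>sawtooth x\<bar> \<le> 1 / 2"
  unfolding sawtooth_def by linarith

lemma sawtooth_of_int: "sawtooth (of_int k) = - 1 / 2"
  by (simp add: sawtooth_def)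

lemma sawtooth_minus:
  assumes "x \<notin> \<int>"
  shows "sawtooth (- x) = - sawtooth x"
proof -
  have "\<lfloor>- x\<rfloor> = - \<lfloor>x\<rfloor> - 1"
    using assms by (metis Ints_of_int ceiling_altdef floor_minus minus_diff_eq
        add.commute diff_minus_eq_add minus_add_distrib uminus_add_conv_diff)
  then show ?thesis by (simp add: sawtooth_def)
qed

text \<open>The sawtooth is odd except at integers, where the value -1/2 breaks the symmetry
  downwards.\<close>

lemma sawtooth_add_sawtooth_minus_nonpos: "sawtooth x + sawtooth (- x) \<le> 0"
proof (cases "x \<in> \<int>")
  case True
  then obtain k where "x = of_int k" by (auto elim: Ints_cases)
  then show ?thesis using sawtooth_of_int[of k] sawtooth_of_int[of "- k"] by simp
next
  case False
  then show ?thesis by (simp add: sawtooth_minus)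
qed

lemma sawtooth_sum_eq:
  "sawtooth_sum r T = (\<Sum>m\<in>{1..nat \<lfloor>T\<rfloor>}. sawtooth (T / (real m + r)) / real m)"
  unfolding sawtooth_sum_def
proof (rule sum.reindex_bij_witness[of _ int nat])
  fix m :: int assume "m \<in> {m. 1 \<le> m \<and> of_int m \<le> T}"
  then show "int (nat m) = m" "nat m \<in> {1..nat \<lfloor>T\<rfloor>}"
    "sawtooth (T / (real (nat m) + r)) / real (nat m) = 1 / of_int m * sawtooth (T / (of_int m + r))"
    by (auto simp: le_floor_iff nat_le_eq_zle)
next
  fix m :: nat assume m: "m \<in> {1..nat \<lfloor>T\<rfloor>}"
  then have "int m \<le> \<lfloor>T\<rfloor>" by auto
  then have "real m \<le> T" by (simp add: le_floor_iff)
  with m show "int m \<in> {m. 1 \<le> m \<and> of_int m \<le> T}" by auto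
qed simp

lemma le_nat_floor_iff: "m > 0 \<Longrightarrow> m \<le> nat \<lfloor>x\<rfloor> \<longleftrightarrow> real m \<le> x"
  by (cases "x \<ge> 0") (auto simp: le_nat_iff le_floor_iff)

section \<open>Large denominators\<close>

text \<open>The error \<open>d K\<close> decreases by the midpoint bound for ln (K + 1) - ln K, and
  the trapezoid bound limits each decrease to a telescoping difference.\<close>

lemma ln_fact_stirling:
  assumes "K \<ge> 1"
  shows "\<bar>ln (fact K) - (K * ln K - K + ln K / 2)\<bar> \<le> 1"
proof -
  define d where "d K = ln (fact K) - (real K * ln K - K + ln K / 2)" for K :: nat
  have that_step: "d (Suc K) \<le> d K" "d K - d (Suc K) \<le> 1 / (4 * real K) - 1 / (4 * real (Suc K))"
    if "K \<ge> 1" for K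
  proof -
    define l where "l = ln (real K + 1) - ln (real K)"
    have "ln (fact (Suc K)) = ln (real K + 1) + ln (fact K)"
      unfolding fact_Suc of_nat_mult by (subst ln_mult) (auto simp: add_ac)
    then have d: "d K - d (Suc K) = (K + 1 / 2) * l - 1"
      unfolding d_def l_def by (simp add: algebra_simps add_divide_distrib)
    have "l \<ge> 2 / (2 * real K + 1)"
      using ln_inverse_approx_ge[of "real K" "real K + 1"] that by (simp add: l_def add_ac)
    then have "(K + 1 / 2) * l \<ge> 1"
      using that by (simp add: field_simps)
    then show "d (Suc K) \<le> d K" using d by simp
    have "l \<le> (inverse (real K) + inverse (real K + 1)) / 2"
      using ln_inverse_approx_le[of "real K" 1] that by (simp add: l_def)
    then have "(K + 1 / 2) * l \<le> (K + 1 / 2) * ((inverse (real K) + inverse (real K + 1)) / 2)"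
      by (intro mult_left_mono) auto
    also have "\<dots> = 1 + (1 / (4 * real K) - 1 / (4 * real (Suc K)))"
      using that by (simp add: divide_simps) (simp add: algebra_simps)
    finally show "d K - d (Suc K) \<le> 1 / (4 * real K) - 1 / (4 * real (Suc K))" using d by simp
  qed
  \<comment> \<open>Induction starts from d 1 = 1 = 3/4 + 1/4; the summand 1/(4K) absorbs exactly
    the allowed decrease of each step.\<close>
  have "d K \<le> 1 \<and> d K \<ge> 3 / 4 + 1 / (4 * real K)"
    using assms
  proof (induction K rule: dec_induct)
    case base
    then show ?case by (simp add: d_def)
  next
    case (step n)
    then show ?case using step(3) that_step[OF step(1)] by linarith
  qed
  moreover have "1 / (4 * real K) \<ge> 0" by simp
  ultimately show ?thesis unfolding d_def by linarith
qed

lemma sum_inverse_bounds: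
  fixes x :: real
  assumes "1 \<le> M" "real M \<le> x"
  shows "(\<Sum>m\<in>{M<..nat \<lfloor>x\<rfloor>}. 1 / real m) \<le> ln x - ln M"
    and "(\<Sum>m\<in>{M<..nat \<lfloor>x\<rfloor>}. 1 / real m) \<ge> ln x - ln M - 1 / M"
proof -
  define N where "N = nat \<lfloor>x\<rfloor>"
  have N: "M \<le> N" "real N \<le> x" "x < real N + 1"
    using assms unfolding N_def by (auto simp: le_nat_floor of_nat_floor)
  have "(\<Sum>m\<in>{M<..N}. 1 / real m) \<le> ln N - ln M \<and>
        (\<Sum>m\<in>{M<..N}. 1 / real m) \<ge> ln (N + 1) - ln (M + 1)"
    using N(1)
  proof (induction N rule: dec_induct)
    case (step n)
    have n: "n \<ge> 1" using step assms by simp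
    have *: "{M<..Suc n} = insert (Suc n) {M<..n}" using step by auto
    have "1 / (real n + 1) \<le> ln (real n + 1) - ln n"
      using ln_diff_le[of n "real n + 1"] n by (simp add: field_simps)
    moreover have "ln (real n + 2) - ln (real n + 1) \<le> 1 / (real n + 1)"
      using ln_diff_le[of "real n + 2" "real n + 1"] n by (simp add: field_simps)
    ultimately show ?case using step * by (simp add: add_ac)
  qed simp
  moreover have "ln N \<le> ln x" "ln x \<le> ln (real N + 1)" using N assms by auto
  moreover have "ln (real M + 1) - ln M \<le> 1 / M"
    using ln_diff_le[of "real M + 1" M] assms by (simp add: field_simps)
  ultimately have "(\<Sum>m\<in>{M<..N}. 1 / real m) \<le> ln x - ln M \<and>
    (\<Sum>m\<in>{M<..N}. 1 / real m) \<ge> ln x - ln M - 1 / M"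
    by (simp add: add_ac)
  then show "(\<Sum>m\<in>{M<..nat \<lfloor>x\<rfloor>}. 1 / real m) \<le> ln x - ln M"
    "(\<Sum>m\<in>{M<..nat \<lfloor>x\<rfloor>}. 1 / real m) \<ge> ln x - ln M - 1 / M"
    using N(1) unfolding N_def by (simp_all add: add_ac)
qed

text \<open>Each term lies between 1/((m+r)(m+r+1)) and 1/((m-1)m), both of which telescope.\<close>

lemma sum_inverse_mult_bounds:
  fixes r :: real
  assumes "1 \<le> M" "M \<le> N" "r \<ge> 0"
  shows "(\<Sum>m\<in>{M<..N}. 1 / (real m * (real m + r))) \<le> 1 / real M - 1 / real N"
    and "(\<Sum>m\<in>{M<..N}. 1 / (real m * (real m + r))) \<ge> 1 / (real M + 1 + r) - 1 / (real N + 1 + r)"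
proof -
  have "(\<Sum>m\<in>{M<..N}. 1 / (real m * (real m + r))) \<le> 1 / real M - 1 / real N \<and>
        (\<Sum>m\<in>{M<..N}. 1 / (real m * (real m + r))) \<ge> 1 / (real M + 1 + r) - 1 / (real N + 1 + r)"
    using assms(2)
  proof (induction N rule: dec_induct)
    case (step n)
    have n: "n \<ge> 1" using step assms by simp
    have *: "{M<..Suc n} = insert (Suc n) {M<..n}" using step by auto
    have "1 / ((real n + 1) * (real n + 1 + r)) \<le> 1 / ((real n + 1) * real n)"
      using n assms by (intro divide_left_mono mult_left_mono mult_pos_pos) auto
    also have "\<dots> = 1 / n - 1 / (n + 1)"
      using n by (simp add: field_simps)
    finally have 1: "1 / ((real n + 1) * (real n + 1 + r)) \<le> 1 / n - 1 / (n + 1)" .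
    have "1 / (n + 1 + r) - 1 / (n + 2 + r) = 1 / ((n + 2 + r) * (n + 1 + r))"
      using assms by (simp add: divide_simps)
    also have "\<dots> \<le> 1 / ((real n + 1) * (real n + 1 + r))"
      using n assms by (intro divide_left_mono mult_mono mult_pos_pos) auto
    finally have "1 / (n + 1 + r) - 1 / (n + 2 + r) \<le> 1 / ((real n + 1) * (real n + 1 + r))" .
    then show ?case using 1 step * by (simp add: add_ac)
  qed simp
  then show "(\<Sum>m\<in>{M<..N}. 1 / (real m * (real m + r))) \<le> 1 / real M - 1 / real N"
    "(\<Sum>m\<in>{M<..N}. 1 / (real m * (real m + r))) \<ge> 1 / (real M + 1 + r) - 1 / (real N + 1 + r)"
    by blast+
qed

text \<open>Exchanging the order of summation in the sum of \<open>\<lfloor>T / (m + r)\<rfloor> / m\<close> turns it into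
  \<open>\<Sum>k\<le>K. ln (T / (k M))\<close>, and Stirling's formula makes all main terms cancel.\<close>

lemma sawtooth_tail_bounded:
  fixes r T :: real
  assumes r: "r \<ge> 0" and M: "M \<ge> 1" and T: "M + r \<le> T" "T \<le> real M ^ 2"
  shows "\<bar>\<Sum>m\<in>{M<..nat \<lfloor>T\<rfloor>}. sawtooth (T / (real m + r)) / real m\<bar> \<le> 5 * (1 + r)"
proof -
  define N where "N = nat \<lfloor>T\<rfloor>"
  define K where "K = nat \<lfloor>T / (M + r)\<rfloor>"
  define X where "X = T / M"
  have T0: "T > 0" "real M \<le> T" using T M r by linarith+
  have M0: "real M > 0" "real M + r > 0" using M r by auto
  have N: "M \<le> N" "real N \<le> T" "T < real N + 1"
    using T0 M unfolding N_def by (auto simp: le_nat_floor of_nat_floor)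
  have "T / (M + r) \<ge> 1" using T M0 by simp
  then have K: "K \<ge> 1" "real K \<le> T / (M + r)" "T / (M + r) < real K + 1"
    unfolding K_def by (auto simp: le_nat_floor of_nat_floor)
  \<comment> \<open>This form of the hypothesis T <= M^2 makes every shift by r or 1 in a
    denominator near M change T/M by a bounded amount only.\<close>
  have TM: "T / M ^ 2 \<le> 1" using T M0 by simp
  have "T / (M + r) \<le> X" unfolding X_def using T0 M0 r by (intro divide_left_mono) auto
  then have KX: "K \<le> X" using K by linarith
  have "X - T / (M + r) = T * r / (M * (M + r))"
    unfolding X_def using M0 by (simp add: field_simps)
  also have "\<dots> \<le> T * r / (M * M)"
    using T0 M0 r by (intro divide_left_mono mult_left_mono mult_pos_pos) auto
  also have "\<dots> = T / M ^ 2 * r" by (simp add: power2_eq_square)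
  also have "\<dots> \<le> 1 * r" using TM r by (intro mult_right_mono) auto
  finally have XK: "X \<le> real K + 1 + r" using K by linarith
  \<comment> \<open>K is at most M, so K errors of size (1 + r)/M add up to at most 1 + r.\<close>
  have KM: "real K / M \<le> 1"
  proof -
    have "real K / M \<le> X / M" using KX M0 by (simp add: divide_right_mono)
    also have "\<dots> = T / M ^ 2" by (simp add: X_def power2_eq_square)
    finally show ?thesis using TM by linarith
  qed
  have lnXK: "ln X - ln K \<le> (1 + r) / K" "ln K \<le> ln X"
  proof -
    have "ln X - ln K \<le> (X - K) / K" using KX K by (intro ln_diff_le) auto
    also have "\<dots> \<le> (1 + r) / K" using XK K by (intro divide_right_mono) auto
    finally show "ln X - ln K \<le> (1 + r) / K" .
  qed (use KX K in auto)
  have KlnXK: "real K * ln X - real K * ln K \<le> 1 + r" "real K * ln X - real K * ln K \<ge> 0" "ln X - ln K \<le> 1 + r"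
  proof -
    show "real K * ln X - real K * ln K \<le> 1 + r"
      using lnXK(1) K(1) by (simp add: field_simps)
    show "real K * ln X - real K * ln K \<ge> 0"
      using lnXK(2) by (simp add: mult_left_mono)
    have "(1 + r) / K \<le> (1 + r) / 1" using r K(1) by (intro divide_left_mono) auto
    then show "ln X - ln K \<le> 1 + r" using lnXK(1) by simp
  qed
  define F where "F = (\<Sum>m\<in>{M<..N}. of_int \<lfloor>T / (m + r)\<rfloor> / real m)"
  define G where "G = T * (\<Sum>m\<in>{M<..N}. 1 / (real m * (real m + r)))"
  define H where "H = (\<Sum>m\<in>{M<..N}. 1 / real m)"
  \<comment> \<open>Up to bounded errors, G is K, H is ln X, and F is K ln X - ln K!, which by
    Stirling is K ln (X/K) + K - (ln K)/2. Since K ln (X/K) and ln (X/K) are bounded, everything in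
    G - F - H/2 cancels.\<close>
  have split: "(\<Sum>m\<in>{M<..N}. sawtooth (T / (real m + r)) / real m) = G - F - H / 2"
    unfolding F_def G_def H_def sawtooth_def sum_distrib_left sum_divide_distrib
      sum_subtractf[symmetric]
    by (intro sum.cong) (simp_all add: diff_divide_distrib mult.commute)
  have H: "H \<le> ln X" "H \<ge> ln X - 1"
  proof -
    have "1 / real M \<le> 1" using M by simp
    moreover have "ln X = ln T - ln M" unfolding X_def using T0 M0 by (simp add: ln_div)
    ultimately show "H \<le> ln X" "H \<ge> ln X - 1"
      using sum_inverse_bounds[OF M T0(2)] unfolding H_def N_def by linarith+
  qed
  have G: "G \<le> real K + 1 + r" "G \<ge> real K - 2 - r"
  proof -
    have "G \<le> T * (1 / M - 1 / N)"
      unfolding G_def using T0 sum_inverse_mult_bounds[OF M N(1) r] by (intro mult_left_mono) auto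
    also have "\<dots> \<le> X" unfolding X_def using T0 by (simp add: algebra_simps)
    finally show "G \<le> real K + 1 + r" using XK by linarith
    have "G \<ge> T * (1 / (M + 1 + r) - 1 / (N + 1 + r))"
      unfolding G_def using T0 sum_inverse_mult_bounds[OF M N(1) r] by (intro mult_left_mono) (auto simp: add_ac)
    moreover have "T / (N + 1 + r) \<le> 1" using N r by simp
    moreover have "X - T / (M + 1 + r) \<le> 1 + r"
    proof -
      have "X - T / (M + 1 + r) = T * (1 + r) / (M * (M + 1 + r))"
        unfolding X_def using M0 by (simp add: field_simps)
      also have "\<dots> \<le> T * (1 + r) / (M * M)"
        using T0 M0 r by (intro divide_left_mono mult_left_mono mult_pos_pos) auto
      also have "\<dots> = T / M ^ 2 * (1 + r)" by (simp add: power2_eq_square)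
      also have "\<dots> \<le> 1 * (1 + r)" using TM r by (intro mult_right_mono) auto
      finally show ?thesis by simp
    qed
    ultimately show "G \<ge> real K - 2 - r" using KX by (simp add: algebra_simps)
  qed
  have "F = (\<Sum>m\<in>{M<..N}. \<Sum>k\<in>{k\<in>{1..K}. real k * (real m + r) \<le> T}. 1 / real m)"
    unfolding F_def
  proof (intro sum.cong refl)
    fix m assume m: "m \<in> {M<..N}"
    then have mr: "real m + r > 0" "real m \<ge> real M" using r by auto
    have "T / (m + r) \<le> T / (M + r)"
      using T0 M0 mr by (intro divide_left_mono) auto
    then have le: "nat \<lfloor>T / (m + r)\<rfloor> \<le> K"
      unfolding K_def by (intro nat_mono floor_mono)
    have "{k\<in>{1..K}. real k * (real m + r) \<le> T} = {1..nat \<lfloor>T / (m + r)\<rfloor>}"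
    proof -
      have "real k * (real m + r) \<le> T \<longleftrightarrow> k \<le> nat \<lfloor>T / (m + r)\<rfloor>" if "k \<ge> 1" for k
        using mr T0 that by (simp add: le_nat_floor_iff field_simps)
      then show ?thesis using le by auto
    qed
    then show "of_int \<lfloor>T / (m + r)\<rfloor> / real m =
        (\<Sum>k\<in>{k\<in>{1..K}. real k * (real m + r) \<le> T}. 1 / real m)"
      using T0 mr by simp
  qed
  also have "\<dots> = (\<Sum>k\<in>{1..K}. \<Sum>m\<in>{m\<in>{M<..N}. real k * (real m + r) \<le> T}. 1 / real m)"
    by (rule sum.swap_restrict) auto
  also have "\<dots> = (\<Sum>k\<in>{1..K}. \<Sum>m\<in>{M<..nat \<lfloor>T / k - r\<rfloor>}. 1 / real m)"
  proof (intro sum.cong refl)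
    fix k assume k: "k \<in> {1..K}"
    have "T / k \<le> T" using k T0 by (simp add: field_simps)
    then have "nat \<lfloor>T / k - r\<rfloor> \<le> N" unfolding N_def using r by (intro nat_mono floor_mono) simp
    moreover have "real k * (real m + r) \<le> T \<longleftrightarrow> m \<le> nat \<lfloor>T / k - r\<rfloor>" if "m > M" for m
      using k that by (simp add: le_nat_floor_iff field_simps)
    ultimately show "{m\<in>{M<..N}. real k * (real m + r) \<le> T} = {M<..nat \<lfloor>T / k - r\<rfloor>}"
      by auto
  qed
  finally have F_eq: "F = (\<Sum>k\<in>{1..K}. \<Sum>m\<in>{M<..nat \<lfloor>T / k - r\<rfloor>}. 1 / real m)" .
  \<comment> \<open>The condition k <= K is what makes T/k - r at least M. Dropping r inside the
    logarithm costs r/M, and comparing the harmonic sum with a logarithm costs 1/M.\<close>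
  have inner: "(\<Sum>m\<in>{M<..nat \<lfloor>T / k - r\<rfloor>}. 1 / real m) \<le> ln X - ln k \<and>
      (\<Sum>m\<in>{M<..nat \<lfloor>T / k - r\<rfloor>}. 1 / real m) \<ge> ln X - ln k - (1 + r) / M"
    if k: "k \<in> {1..K}" for k
  proof -
    have "real k \<le> T / (M + r)" using k K by simp
    then have "k * (M + r) \<le> T" using M0 by (simp add: field_simps)
    then have x: "M \<le> T / k - r" using k by (simp add: field_simps)
    have "ln (T / k) - ln (T / k - r) \<le> (T / k - (T / k - r)) / (T / k - r)"
      using x M0 r by (intro ln_diff_le) auto
    also have "\<dots> \<le> r / M" using x M0 r by (auto intro!: divide_left_mono mult_pos_pos)
    finally have 1: "ln (T / k - r) \<ge> ln (T / k) - r / M" by simp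
    have 2: "ln (T / k - r) \<le> ln (T / k)" using x M0 r by (subst ln_le_cancel_iff) auto
    have "ln (T / k) - ln M = ln X - ln k"
      unfolding X_def using T0 k M0 by (simp add: ln_div)
    then show ?thesis
      using 1 2 sum_inverse_bounds[OF M x] by (simp add: add_divide_distrib)
  qed
  have lnfact: "(\<Sum>k\<in>{1..K}. ln (real k)) = ln (fact K)"
    by (induction K) (simp_all add: ln_mult add.commute del: of_nat_Suc)
  have "F \<le> (\<Sum>k\<in>{1..K}. ln X - ln k)"
    unfolding F_eq using inner by (intro sum_mono) blast
  then have F1: "F \<le> real K * ln X - ln (fact K)"
    using lnfact by (simp add: sum_subtractf)
  have "F \<ge> (\<Sum>k\<in>{1..K}. ln X - ln k - (1 + r) / M)"
    unfolding F_eq using inner by (intro sum_mono) blast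
  then have "F \<ge> real K * ln X - ln (fact K) - real K / M * (1 + r)"
    using lnfact by (simp add: sum_subtractf)
  moreover have "real K * ln X - ln (fact K) - 1 * (1 + r)
      \<le> real K * ln X - ln (fact K) - real K / M * (1 + r)"
    using KM r by (intro diff_left_mono mult_right_mono) auto
  ultimately have F2: "F \<ge> real K * ln X - ln (fact K) - 1 * (1 + r)"
    by (rule order_trans[rotated])
  have "\<bar>G - F - H / 2\<bar> \<le> 5 * (1 + r)"
    using F1 F2 G H KlnXK lnXK(2) ln_fact_stirling[OF K(1)] r unfolding abs_le_iff by argo
  then show ?thesis using split unfolding N_def by simp
qed

section \<open>Averages over an arithmetic progression\<close>

lemma sum_window_periodic:
  fixes f :: "nat \<Rightarrow> real"
  assumes "\<And>n. f (n + q) = f n"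
  shows "sum f {N..<N + q} = sum f {..<q}"
proof (induction N)
  case 0
  then show ?case by (simp add: atLeast0LessThan)
next
  case (Suc N)
  have "sum f {N..<N + q} + f (N + q) = f N + sum f {Suc N..<Suc N + q}"
    using sum.atLeastLessThan_Suc[of N "N + q" f] sum.atLeast_Suc_lessThan[of N "Suc (N + q)" f]
    by simp
  then show ?case using Suc assms[of N] by simp
qed

text \<open>Full periods are removed from the left, each with a nonpositive sum. What remains has
  fewer than q terms, each at most B, so no lower bound on f is needed.\<close>

lemma sum_periodic_le:
  fixes f :: "nat \<Rightarrow> real"
  assumes per: "\<And>n. f (n + q) = f n" and bd: "\<And>n. f n \<le> B" and B: "B \<ge> 0"
    and nonpos: "sum f {..<q} \<le> 0" and q: "q > 0"
  shows "sum f {N..<N + L} \<le> B * q"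
proof (induction L arbitrary: N rule: less_induct)
  case (less L)
  show ?case
  proof (cases "L < q")
    case True
    have "sum f {N..<N + L} \<le> of_nat (card {N..<N + L}) * B"
      by (rule sum_bounded_above) (use bd in auto)
    also have "\<dots> \<le> B * q" using True B by (simp add: mult.commute mult_left_mono)
    finally show ?thesis .
  next
    case False
    then have "sum f {N..<N + L} = sum f {N..<N + q} + sum f {N + q..<(N + q) + (L - q)}"
      by (simp add: sum.atLeastLessThan_concat)
    also have "\<dots> \<le> 0 + B * q"
      using less[of "L - q" "N + q"] False q sum_window_periodic[of f, OF per] nonpos
      by (intro add_mono) auto
    finally show ?thesis by simp
  qed
qed

lemma sum_reflect_periodic:
  fixes f :: "nat \<Rightarrow> real"
  assumes "\<And>n. f (n + q) = f n"
  shows "sum f {..<q} = (\<Sum>n<q. f (q - n))"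
proof -
  have "sum f {..<q} = sum f {1..<1 + q}"
    using sum_window_periodic[of f q 1] assms by simp
  also have "\<dots> = (\<Sum>n<q. f (q - n))"
    by (rule sum.reindex_bij_witness[of _ "\<lambda>n. q - n" "\<lambda>n. q - n"]) auto
  finally show ?thesis .
qed

lemma sawtooth_progression_periodic:
  fixes h q :: nat and d :: real
  assumes "q > 0"
  shows "sawtooth ((real h * real (n + q) + d) / q) = sawtooth ((real h * real n + d) / q)"
proof -
  have "(real h * real (n + q) + d) / q = (real h * real n + d) / q + of_int (int h)"
    using assms by (simp add: field_simps)
  then show ?thesis by (simp only: sawtooth_add_int)
qed

text \<open>Over a full period, the terms \<open>n\<close> and \<open>q - n\<close> are paired.\<close>

lemma sum_period_sawtooth_nonpos:
  fixes h q :: nat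
  assumes q: "q > 0"
  shows "(\<Sum>n<q. sawtooth (real h * real n / q)) \<le> 0"
proof -
  define f where "f n = sawtooth (real h * real n / q)" for n
  have "f (n + q) = f n" for n
    using sawtooth_progression_periodic[OF q, of h n 0] by (simp add: f_def)
  then have "sum f {..<q} = (\<Sum>n<q. f (q - n))" by (rule sum_reflect_periodic)
  also have "\<dots> = (\<Sum>n<q. sawtooth (- (real h * real n / q)))"
  proof (intro sum.cong refl)
    fix n assume "n \<in> {..<q}"
    then have "real h * real (q - n) / q = - (real h * real n / q) + of_int (int h)"
      using q by (simp add: field_simps of_nat_diff)
    then show "f (q - n) = sawtooth (- (real h * real n / q))"
      unfolding f_def by (simp only: sawtooth_add_int)
  qed
  finally have "2 * sum f {..<q} =
      (\<Sum>n<q. sawtooth (real h * real n / q) + sawtooth (- (real h * real n / q)))"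
    by (simp add: sum.distrib f_def)
  also have "\<dots> \<le> 0" by (intro sum_nonpos sawtooth_add_sawtooth_minus_nonpos)
  finally show ?thesis by (simp add: f_def)
qed

text \<open>Reflecting n to q - n turns the shift -1/2 into +1/2 and changes the sign, so twice the
  sum is the sum of f n - g n. Each difference is a nonnegative jump of the floor minus 1/q; the q
  losses of 1/q are paid for by the jump of 1 at n = 0.\<close>

lemma sum_period_sawtooth_half_nonneg:
  fixes h q :: nat
  assumes q: "q > 0"
  shows "(\<Sum>n<q. sawtooth ((real h * real n + (- 1 / 2)) / q)) \<ge> 0"
proof -
  define f where "f n = sawtooth ((real h * real n + (- 1 / 2)) / q)" for n
  define g where "g n = sawtooth ((real h * real n + 1 / 2) / q)" for n
  have fl: "\<lfloor>(real h * real n + 1 / 2) / q\<rfloor> = int ((h * n) div q)" for n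
  proof (rule floor_unique)
    have "real (q * ((h * n) div q)) \<le> real (h * n)"
      by (simp only: of_nat_le_iff) simp
    then show "of_int (int ((h * n) div q)) \<le> (real h * real n + 1 / 2) / q"
      using q by (simp add: field_simps)
    have "h * n < q * ((h * n) div q) + q"
      using q by (metis add.commute add_less_cancel_left mod_less_divisor mult_div_mod_eq)
    then have "real (h * n) + 1 \<le> real (q * ((h * n) div q) + q)"
      by (metis Suc_eq_plus1 Suc_leI of_nat_1 of_nat_add of_nat_le_iff)
    then show "(real h * real n + 1 / 2) / q < of_int (int ((h * n) div q)) + 1"
      using q by (simp add: field_simps)
  qed
  \<comment> \<open>An integer value would equate the odd number 2 h n + 1 with an even one.
    Non-integrality is what permits the use of oddness.\<close>
  have nonint: "(real h * real n + 1 / 2) / q \<notin> \<int>" for n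
  proof
    assume "(real h * real n + 1 / 2) / q \<in> \<int>"
    then have "(real h * real n + 1 / 2) / q = real ((h * n) div q)"
      using fl[of n] by (metis Ints_cases floor_of_int of_int_of_nat_eq)
    then have "2 * real h * real n + 1 = 2 * real ((h * n) div q) * q"
      using q by (simp add: field_simps)
    then have "real (2 * h * n + 1) = real (2 * ((h * n) div q) * q)" by simp
    then have "2 * h * n + 1 = 2 * ((h * n) div q) * q" by (simp only: of_nat_eq_iff)
    moreover have "odd (2 * h * n + 1)" "even (2 * ((h * n) div q) * q)" by simp_all
    ultimately show False by metis
  qed
  have "f (n + q) = f n" for n
    unfolding f_def by (rule sawtooth_progression_periodic[OF q])
  then have "sum f {..<q} = (\<Sum>n<q. f (q - n))" by (rule sum_reflect_periodic)
  also have "\<dots> = (\<Sum>n<q. - g n)"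
  proof (intro sum.cong refl)
    fix n assume "n \<in> {..<q}"
    then have "(real h * real (q - n) + (- 1 / 2)) / q = - ((real h * real n + 1 / 2) / q) + of_int (int h)"
      using q by (simp add: field_simps of_nat_diff)
    then show "f (q - n) = - g n"
      unfolding f_def g_def by (simp only: sawtooth_add_int sawtooth_minus[OF nonint])
  qed
  finally have "2 * sum f {..<q} = (\<Sum>n<q. f n - g n)"
    by (simp add: sum_subtractf sum_negf)
  also have "\<dots> \<ge> (\<Sum>n<q. (if n = 0 then 1 else 0) - 1 / q)"
  proof (intro sum_mono)
    fix n assume "n \<in> {..<q}"
    have "(real h * real n + (- 1 / 2)) / q = (real h * real n + 1 / 2) / q - 1 / q"
      using q by (simp add: field_simps)
    then have "f n - g n =
        of_int (\<lfloor>(real h * real n + 1 / 2) / q\<rfloor> - \<lfloor>(real h * real n + (- 1 / 2)) / q\<rfloor>) - 1 / q"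
      by (simp add: f_def g_def sawtooth_def)
    moreover have "\<lfloor>(real h * real n + (- 1 / 2)) / q\<rfloor> \<le> \<lfloor>(real h * real n + 1 / 2) / q\<rfloor>"
      using q by (intro floor_mono divide_right_mono) auto
    moreover have "\<lfloor>(- 1 / 2) / real q\<rfloor> = -1" "\<lfloor>(1 / 2) / real q\<rfloor> = 0"
      using q by (auto simp: floor_eq_iff field_simps)
    ultimately show "(if n = 0 then 1 else 0) - 1 / q \<le> f n - g n"
      by (cases "n = 0") auto
  qed
  moreover have "(\<Sum>n<q. (if n = 0 then 1 else 0) - 1 / real q) = 0"
    using q by (simp add: sum_subtractf)
  ultimately show ?thesis by (simp add: f_def)
qed

text \<open>This is the sum D of the overview. For A > 0, divisibility forces m <= A, so the cutoff
  2 A^2 removes no term; it matches the range over which the average is taken.\<close>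

definition resonance :: "nat \<Rightarrow> nat \<Rightarrow> nat \<Rightarrow> real" where
  "resonance a b A = (\<Sum>m\<in>{m\<in>{1..2 * A ^ 2}. (b * m + a) dvd b * A}. 1 / real m)"

text \<open>If all T = A n exceeded the bound, so would their mean. A resonant m gives an integer
  argument for every n, hence the value -1/2 throughout; any other m gives a sequence in n of period
  b m + a with nonpositive sum over a period.\<close>

lemma sawtooth_average_le:
  fixes a b A :: nat
  assumes b: "b > 0" and A: "A \<ge> 1"
  shows "\<exists>T. real A ^ 4 \<le> T \<and> T \<le> 2 * real A ^ 4 \<and>
    (\<Sum>m\<in>{1..2 * A ^ 2}. sawtooth (T / (real m + real a / real b)) / real m)
      \<le> - resonance a b A / 2 + (real a + real b)"
proof (rule ccontr)
  define M where "M = 2 * A ^ 2"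
  define f where "f m n = sawtooth (real (b * A) * real n / real (b * m + a))" for m n :: nat
  define X where "X = - resonance a b A / 2 + (real a + real b)"
  define R where "R = {m\<in>{1..M}. (b * m + a) dvd b * A}"
  assume contra: "\<not> ?thesis"
  have big: "X < (\<Sum>m\<in>{1..M}. f m n / real m)" if n: "n \<in> {A ^ 3..<A ^ 3 + A ^ 3}" for n
  proof -
    have "real (A * A ^ 3) \<le> real (A * n)" "real (A * n) \<le> real (A * (2 * A ^ 3))"
      using n unfolding of_nat_le_iff by (intro mult_le_mono; simp)+
    then have T: "real A ^ 4 \<le> real (A * n)" "real (A * n) \<le> 2 * real A ^ 4"
      by (simp_all add: eval_nat_numeral)
    have "real (A * n) / (real m + real a / real b) = real (b * A) * real n / real (b * m + a)" for m
      using b by (simp add: field_simps)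
    then show ?thesis using contra T unfolding X_def M_def f_def by (metis (no_types, lifting) not_le sum.cong)
  qed
  have row: "(\<Sum>n\<in>{A ^ 3..<A ^ 3 + A ^ 3}. f m n / real m)
      \<le> (if m \<in> R then - (real A ^ 3 / 2) * (1 / real m) else 0) + (real a + real b) / 2"
    if m: "m \<in> {1..M}" for m
  proof (cases "m \<in> R")
    case True
    then obtain h where h: "b * A = (b * m + a) * h" unfolding R_def by (auto elim: dvdE)
    have "f m n = - 1 / 2" for n
    proof -
      have "real (b * A) * real n / real (b * m + a) = of_int (int (h * n))"
      proof -
        have *: "real (q * h) * real n / real q = of_int (int (h * n))" if "q > 0" for q
          using that by simp
        have "b * m + a > 0" using m b by simp
        then show ?thesis unfolding h by (rule *)
      qed
      then show ?thesis unfolding f_def by (simp only: sawtooth_of_int)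
    qed
    then show ?thesis using True by simp
  next
    case False
    have q: "b * m + a > 0" using m b by simp
    have "(\<Sum>n\<in>{A ^ 3..<A ^ 3 + A ^ 3}. f m n) \<le> 1 / 2 * real (b * m + a)"
    proof (rule sum_periodic_le)
      show "f m (n + (b * m + a)) = f m n" for n
        using sawtooth_progression_periodic[OF q, of "b * A" n 0] unfolding f_def by simp
      show "f m n \<le> 1 / 2" for n using abs_sawtooth_le unfolding f_def by (metis abs_le_D1)
      show "sum (f m) {..<b * m + a} \<le> 0"
        using sum_period_sawtooth_nonpos[OF q, of "b * A"] unfolding f_def .
    qed (use q in auto)
    then have "(\<Sum>n\<in>{A ^ 3..<A ^ 3 + A ^ 3}. f m n) / real m \<le> (1 / 2 * real (b * m + a)) / real m"
      by (intro divide_right_mono) auto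
    \<comment> \<open>The weight 1/m cancels the growth of the period, so the error of a row is
      bounded independently of m.\<close>
    also have "\<dots> \<le> (real a + real b) / 2"
    proof -
      have "real a * 1 \<le> real a * real m" using m by (intro mult_left_mono) auto
      then show ?thesis using m by (simp add: field_simps)
    qed
    finally show ?thesis using False by (simp add: sum_divide_distrib)
  qed
  have "real A ^ 3 * X = (\<Sum>n\<in>{A ^ 3..<A ^ 3 + A ^ 3}. X)" by simp
  also have "\<dots> < (\<Sum>n\<in>{A ^ 3..<A ^ 3 + A ^ 3}. \<Sum>m\<in>{1..M}. f m n / real m)"
    using big A by (intro sum_strict_mono) auto
  also have "\<dots> = (\<Sum>m\<in>{1..M}. \<Sum>n\<in>{A ^ 3..<A ^ 3 + A ^ 3}. f m n / real m)"
    by (rule sum.swap)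
  also have "\<dots> \<le> (\<Sum>m\<in>{1..M}. (if m \<in> R then - (real A ^ 3 / 2) * (1 / real m) else 0) + (real a + real b) / 2)"
    by (intro sum_mono row)
  also have "\<dots> = - (real A ^ 3 / 2) * resonance a b A + real M * ((real a + real b) / 2)"
  proof -
    have "{1..M} \<inter> R = R" unfolding R_def by auto
    then have "(\<Sum>m\<in>{1..M}. if m \<in> R then - (real A ^ 3 / 2) * (1 / real m) else 0)
        = (\<Sum>m\<in>R. - (real A ^ 3 / 2) * (1 / real m))"
      by (simp only: sum.inter_restrict[symmetric] finite_atLeastAtMost)
    also have "\<dots> = - (real A ^ 3 / 2) * resonance a b A"
      unfolding resonance_def R_def M_def by (simp only: sum_distrib_left)
    finally show ?thesis by (simp add: sum.distrib)
  qed
  also have "\<dots> = - (real A ^ 3 / 2) * resonance a b A + real A ^ 2 * (real a + real b)"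
    by (simp add: M_def)
  \<comment> \<open>The 2 A^2 row errors total A^2 (a + b), which is at most A^3 (a + b), that is, a
    + b for each of the A^3 values of n.\<close>
  also have "\<dots> \<le> - (real A ^ 3 / 2) * resonance a b A + real A ^ 3 * (real a + real b)"
    using A by (intro add_left_mono mult_right_mono power_increasing) auto
  also have "\<dots> = real A ^ 3 * X" unfolding X_def by (simp add: algebra_simps)
  finally show False by simp
qed

lemma sum_inverse_squares_le: "(\<Sum>m\<in>{1..M}. 1 / real m ^ 2) \<le> 2"
proof (cases "M \<ge> 1")
  case True
  have "(\<Sum>m\<in>{1..M}. 1 / real m ^ 2) = 1 + (\<Sum>m\<in>{1<..M}. 1 / (real m * (real m + 0)))"
    using True by (simp add: sum.head power2_eq_square)
  also have "\<dots> \<le> 1 + (1 / real 1 - 1 / real M)"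
    using sum_inverse_mult_bounds(1)[of 1 M 0] True by (intro add_left_mono) simp
  also have "\<dots> \<le> 2" by simp
  finally show ?thesis .
qed simp

text \<open>The shift by \<open>- 1 / (2 b)\<close> moves the arguments with \<open>b m + a\<close> dividing \<open>b A\<close> just below an
  integer, where the sawtooth is close to \<open>1 / 2\<close>.\<close>

lemma sawtooth_average_ge:
  fixes a b A :: nat
  assumes b: "b > 0" and A: "A \<ge> 1"
  shows "\<exists>T. real A ^ 4 - 1 \<le> T \<and> T \<le> 2 * real A ^ 4 \<and>
    (\<Sum>m\<in>{1..2 * A ^ 2}. sawtooth (T / (real m + real a / real b)) / real m)
      \<ge> resonance a b A / 2 - (real a + real b) - 1"
proof (rule ccontr)
  define M where "M = 2 * A ^ 2"
  define f where "f m n = sawtooth ((real (b * A) * real n + (- 1 / 2)) / real (b * m + a))" for m n :: nat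
  define X where "X = resonance a b A / 2 - (real a + real b) - 1"
  define R where "R = {m\<in>{1..M}. (b * m + a) dvd b * A}"
  assume contra: "\<not> ?thesis"
  have big: "X > (\<Sum>m\<in>{1..M}. f m n / real m)" if n: "n \<in> {A ^ 3..<A ^ 3 + A ^ 3}" for n
  proof -
    \<comment> \<open>The shift is chosen so that T b = b A n - 1/2: the numerator over b m + a is
      always an integer minus one half.\<close>
    define T where "T = real (A * n) - 1 / (2 * real b)"
    have "1 / (2 * real b) \<le> 1" "1 / (2 * real b) \<ge> 0" using b by (auto simp: field_simps)
    moreover have "real (A * A ^ 3) \<le> real (A * n)" "real (A * n) \<le> real (A * (2 * A ^ 3))"
      using n unfolding of_nat_le_iff by (intro mult_le_mono; simp)+
    then have "real A ^ 4 \<le> real (A * n)" "real (A * n) \<le> 2 * real A ^ 4"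
      by (simp_all add: eval_nat_numeral)
    ultimately have T: "real A ^ 4 - 1 \<le> T" "T \<le> 2 * real A ^ 4" unfolding T_def by linarith+
    have "T / (real m + real a / real b) = (real (b * A) * real n + (- 1 / 2)) / real (b * m + a)" for m
    proof -
      have "real m + real a / real b = real (b * m + a) / real b"
        using b by (simp add: field_simps)
      moreover have "T * real b = real (b * A) * real n + (- 1 / 2)"
        using b by (simp add: T_def field_simps)
      ultimately show ?thesis by simp
    qed
    then show ?thesis using contra T unfolding X_def M_def f_def by (metis (no_types, lifting) not_le sum.cong)
  qed
  \<comment> \<open>A resonant argument lies 1/(2 (b m + a)) below an integer, so the sawtooth falls
    short of 1/2 by that amount, at most 1/(2m). With the weight 1/m this becomes a convergent sum
    of 1/m^2, bounded by 2, which accounts for the final -1 in the bound.\<close>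
  have row: "(\<Sum>n\<in>{A ^ 3..<A ^ 3 + A ^ 3}. f m n / real m)
      \<ge> (if m \<in> R then (real A ^ 3 / 2) * (1 / real m) else 0) - (real A ^ 3 / 2) * (1 / real m ^ 2) - (real a + real b) / 2"
    if m: "m \<in> {1..M}" for m
  proof (cases "m \<in> R")
    case True
    then obtain h where h: "b * A = (b * m + a) * h" unfolding R_def by (auto elim: dvdE)
    have qn: "b * m + a > 0" "m \<le> b * m + a"
      using m b by (auto simp: trans_le_add1)
    then have q: "real (b * m + a) > 0" "real m \<le> real (b * m + a)"
      by (simp_all only: of_nat_0_less_iff of_nat_le_iff)
    have "f m n = 1 / 2 - 1 / (2 * real (b * m + a))" for n
    proof -
      have *: "(real (b * A) * real n + (- 1 / 2)) / real (b * m + a)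
          = - 1 / (2 * real (b * m + a)) + of_int (int (h * n))"
      proof -
        have **: "(real (q * h) * real n + (- 1 / 2)) / real q = - 1 / (2 * real q) + of_int (int (h * n))"
          if "q > 0" for q
          using that by (simp add: field_simps)
        have "b * m + a > 0" using m b by simp
        then show ?thesis unfolding h by (rule **)
      qed
      have "\<lfloor>- 1 / (2 * real q)\<rfloor> = - 1" if "q > 0" for q :: nat
        by (rule floor_unique) (use that in \<open>auto simp: field_simps\<close>)
      note this[OF qn(1)]
      then show ?thesis unfolding f_def * sawtooth_add_int by (simp add: sawtooth_def)
    qed
    then have "(\<Sum>n\<in>{A ^ 3..<A ^ 3 + A ^ 3}. f m n / real m)
        = real A ^ 3 * ((1 / 2 - 1 / (2 * real (b * m + a))) / real m)"
      by (simp del: of_nat_add of_nat_mult)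
    also have "\<dots> = (real A ^ 3 / 2) * (1 / real m) - (real A ^ 3 / 2) * (1 / (real m * real (b * m + a)))"
      using m q by (simp add: field_simps del: of_nat_add of_nat_mult)
    finally have "(\<Sum>n\<in>{A ^ 3..<A ^ 3 + A ^ 3}. f m n / real m)
        = (real A ^ 3 / 2) * (1 / real m) - (real A ^ 3 / 2) * (1 / (real m * real (b * m + a)))" .
    moreover have "1 / (real m * real (b * m + a)) \<le> 1 / real m ^ 2"
      using m q unfolding power2_eq_square by (intro divide_left_mono mult_left_mono mult_pos_pos) auto
    then have "(real A ^ 3 / 2) * (1 / (real m * real (b * m + a))) \<le> (real A ^ 3 / 2) * (1 / real m ^ 2)"
      by (intro mult_left_mono) auto
    moreover have "(real a + real b) / 2 \<ge> 0" by simp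
    ultimately show ?thesis unfolding if_P[OF True] by linarith
  next
    case False
    have q: "b * m + a > 0" using m b by simp
    have "(\<Sum>n\<in>{A ^ 3..<A ^ 3 + A ^ 3}. - f m n) \<le> 1 / 2 * real (b * m + a)"
    proof (rule sum_periodic_le)
      show "- f m (n + (b * m + a)) = - f m n" for n
        using sawtooth_progression_periodic[OF q, of "b * A" n "- 1 / 2"] unfolding f_def by simp
      show "- f m n \<le> 1 / 2" for n using abs_sawtooth_le unfolding f_def by (metis abs_le_D2)
      show "(\<Sum>n<b * m + a. - f m n) \<le> 0"
        using sum_period_sawtooth_half_nonneg[OF q, of "b * A"] unfolding f_def sum_negf by linarith
    qed (use q in auto)
    then have "- (\<Sum>n\<in>{A ^ 3..<A ^ 3 + A ^ 3}. f m n) / real m \<le> (1 / 2 * real (b * m + a)) / real m"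
      unfolding sum_negf by (intro divide_right_mono) auto
    also have "\<dots> \<le> (real a + real b) / 2"
    proof -
      have "real a * 1 \<le> real a * real m" using m by (intro mult_left_mono) auto
      then show ?thesis using m by (simp add: field_simps)
    qed
    finally have "(\<Sum>n\<in>{A ^ 3..<A ^ 3 + A ^ 3}. f m n / real m) \<ge> - (real a + real b) / 2"
      by (simp add: sum_divide_distrib)
    moreover have "(real A ^ 3 / 2) * (1 / real m ^ 2) \<ge> 0" by simp
    ultimately show ?thesis unfolding if_not_P[OF False] by linarith
  qed
  have "real A ^ 3 * X = real A ^ 3 / 2 * resonance a b A - real A ^ 3 - real A ^ 3 * (real a + real b)"
    unfolding X_def by (simp add: algebra_simps)
  also have "\<dots> \<le> real A ^ 3 / 2 * resonance a b A - real A ^ 3 - real A ^ 2 * (real a + real b)"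
    using A by (intro diff_left_mono mult_right_mono power_increasing) auto
  also have "\<dots> \<le> real A ^ 3 / 2 * resonance a b A - (real A ^ 3 / 2) * (\<Sum>m\<in>{1..M}. 1 / real m ^ 2)
      - real A ^ 2 * (real a + real b)"
  proof -
    have "(\<Sum>m\<in>{1..M}. 1 / real m ^ 2) \<le> 2"
      by (rule sum_inverse_squares_le)
    then have "(real A ^ 3 / 2) * (\<Sum>m\<in>{1..M}. 1 / real m ^ 2) \<le> (real A ^ 3 / 2) * 2"
      by (intro mult_left_mono) auto
    then show ?thesis by simp
  qed
  also have "\<dots> = (\<Sum>m\<in>{1..M}. (if m \<in> R then (real A ^ 3 / 2) * (1 / real m) else 0)
       - (real A ^ 3 / 2) * (1 / real m ^ 2) - (real a + real b) / 2)"
  proof -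
    have "{1..M} \<inter> R = R" unfolding R_def by auto
    then have "(\<Sum>m\<in>{1..M}. if m \<in> R then (real A ^ 3 / 2) * (1 / real m) else 0)
        = (\<Sum>m\<in>R. (real A ^ 3 / 2) * (1 / real m))"
      by (simp only: sum.inter_restrict[symmetric] finite_atLeastAtMost)
    also have "\<dots> = (real A ^ 3 / 2) * resonance a b A"
      unfolding resonance_def R_def M_def by (simp only: sum_distrib_left)
    finally have 1: "(\<Sum>m\<in>{1..M}. if m \<in> R then (real A ^ 3 / 2) * (1 / real m) else 0)
        = (real A ^ 3 / 2) * resonance a b A" .
    have 2: "(\<Sum>m\<in>{1..M}. (real a + real b) / 2) = real A ^ 2 * (real a + real b)"
      by (simp add: M_def)
    show ?thesis unfolding sum_subtractf 1 2 by (simp only: sum_distrib_left)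
  qed
  also have "\<dots> \<le> (\<Sum>m\<in>{1..M}. \<Sum>n\<in>{A ^ 3..<A ^ 3 + A ^ 3}. f m n / real m)"
    by (intro sum_mono row)
  also have "\<dots> = (\<Sum>n\<in>{A ^ 3..<A ^ 3 + A ^ 3}. \<Sum>m\<in>{1..M}. f m n / real m)"
    by (rule sum.swap)
  also have "\<dots> < (\<Sum>n\<in>{A ^ 3..<A ^ 3 + A ^ 3}. X)"
    using big A by (intro sum_strict_mono) auto
  also have "\<dots> = real A ^ 3 * X" by simp
  finally show False by simp
qed

section \<open>Euler products\<close>

lemma sum_divisors_mult_coprime:
  fixes f :: "nat \<Rightarrow> real"
  assumes mult: "\<And>m n. f (m * n) = f m * f n"
    and mn: "coprime m n" "m > 0" "n > 0"
  shows "(\<Sum>d | d dvd m * n. f d) = (\<Sum>d | d dvd m. f d) * (\<Sum>d | d dvd n. f d)"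
proof -
  have inj: "inj_on (\<lambda>(d, e). d * e) ({d. d dvd m} \<times> {e. e dvd n})"
  proof (intro inj_onI, clarify)
    fix d e d' e' :: nat
    assume *: "d dvd m" "e dvd n" "d' dvd m" "e' dvd n" "d * e = d' * e'"
    have "coprime d e'" "coprime d' e"
      using * mn(1) by (meson coprime_divisors)+
    then have "d dvd d'" "d' dvd d"
      using *(5) by (metis coprime_dvd_mult_left_iff dvd_triv_left)+
    then have "d = d'" by (rule dvd_antisym)
    moreover have "d > 0" using *(1) mn by (auto intro: Nat.gr0I)
    ultimately show "d = d' \<and> e = e'" using *(5) by simp
  qed
  have img: "(\<lambda>(d, e). d * e) ` ({d. d dvd m} \<times> {e. e dvd n}) = {d. d dvd m * n}"
  proof
    show "(\<lambda>(d, e). d * e) ` ({d. d dvd m} \<times> {e. e dvd n}) \<subseteq> {d. d dvd m * n}"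
      by (auto intro: mult_dvd_mono)
    show "{d. d dvd m * n} \<subseteq> (\<lambda>(d, e). d * e) ` ({d. d dvd m} \<times> {e. e dvd n})"
    proof
      fix x assume "x \<in> {d. d dvd m * n}"
      then obtain d e where "x = d * e" "d dvd m" "e dvd n"
        using division_decomp[of x m n] by auto
      then show "x \<in> (\<lambda>(d, e). d * e) ` ({d. d dvd m} \<times> {e. e dvd n})" by force
    qed
  qed
  have "(\<Sum>d | d dvd m * n. f d) = (\<Sum>(d, e)\<in>{d. d dvd m} \<times> {e. e dvd n}. f (d * e))"
    unfolding img[symmetric] by (subst sum.reindex[OF inj]) (simp add: case_prod_beta)
  then show ?thesis by (simp add: mult sum_product sum.cartesian_product)
qed

text \<open>Used with n powr (-1 - s) for the zeta sum and with 1/n for the divisor sum of the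
  resonant A.\<close>

lemma sum_divisors_prod_prime_powers:
  fixes f :: "nat \<Rightarrow> real"
  assumes mult: "\<And>m n. f (m * n) = f m * f n" and one: "f 1 = 1"
    and S: "finite S" "\<And>p. p \<in> S \<Longrightarrow> prime p"
  shows "(\<Sum>d | d dvd (\<Prod>p\<in>S. p ^ k). f d) = (\<Prod>p\<in>S. \<Sum>j\<le>k. f p ^ j)"
  using S
proof (induction S rule: finite_induct)
  case empty
  then show ?case using one by simp
next
  case (insert p S)
  have p: "prime p" using insert by simp
  have "coprime (p ^ k) (\<Prod>p\<in>S. p ^ k)"
  proof (rule prod_coprime_right)
    fix q assume q: "q \<in> S"
    then have "prime q" "p \<noteq> q" using insert by auto
    then show "coprime (p ^ k) (q ^ k)" using p by (simp add: primes_coprime)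
  qed
  moreover have "(\<Prod>p\<in>S. p ^ k) > 0"
    using insert by (intro prod_pos) (auto simp: prime_gt_0_nat)
  ultimately have "(\<Sum>d | d dvd (\<Prod>p\<in>insert p S. p ^ k). f d)
      = (\<Sum>d | d dvd p ^ k. f d) * (\<Prod>p\<in>S. \<Sum>j\<le>k. f p ^ j)"
    using insert p by (simp add: sum_divisors_mult_coprime[OF mult] prime_gt_0_nat)
  moreover have "(\<Sum>d | d dvd p ^ k. f d) = (\<Sum>j\<le>k. f p ^ j)"
  proof -
    have "{d. d dvd p ^ k} = (\<lambda>j. p ^ j) ` {..k}"
      using divides_primepow_nat[OF p] by auto
    moreover have "inj_on (\<lambda>j. p ^ j) {..k}"
      using prime_gt_1_nat[OF p] by (auto intro!: inj_onI)
    moreover have "f (p ^ j) = f p ^ j" for j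
      using one by (induction j) (simp_all add: mult)
    ultimately show ?thesis by (simp add: sum.reindex)
  qed
  ultimately show ?case using insert by simp
qed

text \<open>The crude exponent N suffices, because e < p^e <= n for the multiplicity e of p in
  n.\<close>

lemma dvd_prod_prime_powers:
  fixes n N :: nat
  assumes "1 \<le> n" "n \<le> N"
  shows "n dvd (\<Prod>p | prime p \<and> p \<le> N. p ^ N)"
proof -
  have "n = (\<Prod>p\<in>prime_factors n. p ^ multiplicity p n)"
    using prod_prime_factors[of n] assms by simp
  also have "\<dots> dvd (\<Prod>p\<in>prime_factors n. p ^ N)"
  proof (intro prod_dvd_prod le_imp_power_dvd)
    fix p assume p: "p \<in> prime_factors n"
    then have "p > 1" using prime_gt_1_nat by (auto simp: in_prime_factors_iff)
    then have "multiplicity p n < p ^ multiplicity p n" by (intro power_gt_expt) auto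
    also have "\<dots> \<le> n" using assms by (intro dvd_imp_le multiplicity_dvd) auto
    finally show "multiplicity p n \<le> N" using assms by simp
  qed
  also have "\<dots> dvd (\<Prod>p | prime p \<and> p \<le> N. p ^ N)"
  proof (intro prod_dvd_prod_subset)
    show "prime_factors n \<subseteq> {p. prime p \<and> p \<le> N}"
    proof
      fix p assume "p \<in> prime_factors n"
      then have "prime p" "p dvd n" by (auto simp: in_prime_factors_iff)
      moreover have "p \<le> n" using \<open>p dvd n\<close> assms by (intro dvd_imp_le) auto
      ultimately show "p \<in> {p. prime p \<and> p \<le> N}" using assms by simp
    qed
  qed simp
  finally show ?thesis .
qed

text \<open>All n up to N are among the divisors of one large number, and its divisor sum factors
  into truncated geometric series. No infinite product or convergence question arises.\<close>

lemma sum_le_euler_product: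
  fixes f :: "nat \<Rightarrow> real"
  assumes mult: "\<And>m n. f (m * n) = f m * f n" and one: "f 1 = 1"
    and nonneg: "\<And>n. f n \<ge> 0" and less: "\<And>p. prime p \<Longrightarrow> f p < 1"
  shows "(\<Sum>n\<in>{1..N}. f n) \<le> (\<Prod>p | prime p \<and> p \<le> N. 1 / (1 - f p))"
proof -
  have pos: "(\<Prod>p | prime p \<and> p \<le> N. p ^ N) > 0"
    by (intro prod_pos) (auto simp: prime_gt_0_nat)
  have "(\<Sum>n\<in>{1..N}. f n) \<le> (\<Sum>d | d dvd (\<Prod>p | prime p \<and> p \<le> N. p ^ N). f d)"
    using pos nonneg by (intro sum_mono2) (auto intro: dvd_prod_prime_powers)
  also have "\<dots> = (\<Prod>p | prime p \<and> p \<le> N. \<Sum>j\<le>N. f p ^ j)"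
    by (rule sum_divisors_prod_prime_powers[OF mult one]) auto
  also have "\<dots> \<le> (\<Prod>p | prime p \<and> p \<le> N. 1 / (1 - f p))"
  proof (intro prod_mono conjI)
    fix p assume "p \<in> {p. prime p \<and> p \<le> N}"
    then have "f p < 1" "f p \<ge> 0" using less nonneg by auto
    then show "(\<Sum>j\<le>N. f p ^ j) \<le> 1 / (1 - f p)"
      by (simp add: sum_gp0 divide_right_mono)
    show "0 \<le> (\<Sum>j\<le>N. f p ^ j)" using nonneg by (intro sum_nonneg) auto
  qed
  finally show ?thesis .
qed

text \<open>The right-hand side is the integral of x powr (-1 - s) from 1 to N + 1. Its limit 1/s
  for large N is the pole of zeta at 1.\<close>

lemma sum_powr_ge:
  fixes s :: real
  assumes s: "s > 0"
  shows "(\<Sum>n\<in>{1..N}. real n powr (- 1 - s)) \<ge> (1 - (real N + 1) powr (- s)) / s"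
proof (induction N)
  case (Suc N)
  define x where "x = real N + 1"
  have x: "x > 0" by (simp add: x_def)
  have exponent: "- s - 1 = - 1 - s" by simp
  have "\<exists>z. x < z \<and> z < x + 1 \<and>
      (x + 1) powr (- s) - x powr (- s) = (x + 1 - x) * (- s * z powr (- 1 - s))"
    using x by (intro MVT2) (auto intro!: derivative_eq_intros simp: exponent)
  then obtain z where z: "x < z" "(x + 1) powr (- s) - x powr (- s) = - s * z powr (- 1 - s)"
    by auto
  have "z powr (- 1 - s) \<le> x powr (- 1 - s)"
    using z x s by (intro powr_mono2') auto
  then have "s * z powr (- 1 - s) \<le> s * x powr (- 1 - s)"
    using s by (intro mult_left_mono) auto
  then have "x powr (- s) - (x + 1) powr (- s) \<le> s * x powr (- 1 - s)" using z by simp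
  then have "(x powr (- s) - (x + 1) powr (- s)) / s \<le> x powr (- 1 - s)"
    using s by (simp add: field_simps)
  then show ?case using Suc s by (simp add: x_def field_simps)
qed simp

section \<open>A lower bound in Mertens' theorem\<close>

definition mertens_product :: "nat \<Rightarrow> real" where
  "mertens_product y = (\<Prod>p | prime p \<and> p \<le> y. 1 / (1 - 1 / real p))"

text \<open>Concavity of ln at 1 - t x, a convex combination of 1 and 1 - x. With t = p powr (-s)
  and x = 1/p it pulls p powr (-s) out of the logarithm.\<close>

lemma ln_one_minus_mult_ge:
  fixes t x :: real
  assumes "0 \<le> t" "t \<le> 1" "0 \<le> x" "x < 1"
  shows "ln (1 - t * x) \<ge> t * ln (1 - x)"
  using concave_onD[OF ln_concave, of t 1 "1 - x"] assms by (simp add: algebra_simps)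

lemma ln_one_over: "x > 0 \<Longrightarrow> ln (1 / x) = - ln x" for x :: real
  by (simp add: ln_div)

lemma ln_mertens_product:
  "ln (mertens_product y) = (\<Sum>p | prime p \<and> p \<le> y. - ln (1 - 1 / real p))"
proof -
  have "1 - 1 / real p > 0" if "prime p" for p using prime_gt_1_nat[OF that] by simp
  then show ?thesis unfolding mertens_product_def
    by (subst ln_prod) (auto intro!: sum.cong simp del: diff_gt_0_iff_gt simp: ln_one_over)
qed

lemma neg_ln_prime_nonneg:
  assumes "prime (p::nat)"
  shows "- ln (1 - 1 / real p) \<ge> 0"
  using prime_gt_1_nat[OF assms] by simp

lemma ln_mertens_product_mono: "y \<le> z \<Longrightarrow> ln (mertens_product y) \<le> ln (mertens_product z)"
  unfolding ln_mertens_product by (intro sum_mono2) (auto intro: neg_ln_prime_nonneg[simplified])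

text \<open>A finite form of the growth of ln zeta(1 + s). The weights of p powr (-s) are exactly
  the summands of the logarithm of the Mertens product, so the latter can be inserted without an
  error term.\<close>

lemma zeta_le_sum_primes:
  fixes s :: real
  assumes s: "s > 0" and N: "N \<ge> 1"
  shows "ln ((1 - (real N + 1) powr (- s)) / s)
    \<le> (\<Sum>p | prime p \<and> p \<le> N. - ln (1 - 1 / real p) * real p powr (- s))"
proof -
  define f where "f n = real n powr (- 1 - s)" for n :: nat
  have f1: "f p < 1" if "prime p" for p
    using prime_gt_1_nat[OF that] s unfolding f_def by (simp add: powr_less_one)
  have "(real N + 1) powr (- s) < 1"
    using s N by (intro powr_less_one) auto
  then have "ln ((1 - (real N + 1) powr (- s)) / s) \<le> ln (\<Sum>n\<in>{1..N}. f n)"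
    using s sum_powr_ge[OF s, of N] unfolding f_def
    by (subst ln_le_cancel_iff) (auto intro: less_le_trans[rotated])
  also have "\<dots> \<le> ln (\<Prod>p | prime p \<and> p \<le> N. 1 / (1 - f p))"
  proof (rule ln_mono)
    show "(\<Sum>n\<in>{1..N}. f n) \<le> (\<Prod>p | prime p \<and> p \<le> N. 1 / (1 - f p))"
      by (rule sum_le_euler_product) (auto simp: f_def powr_mult f1[unfolded f_def])
    show "0 < (\<Sum>n\<in>{1..N}. f n)" using N unfolding f_def by (intro sum_pos) auto
  qed
  also have "\<dots> = (\<Sum>p | prime p \<and> p \<le> N. - ln (1 - f p))"
  proof (subst ln_prod)
    show "(\<Sum>p | prime p \<and> p \<le> N. ln (1 / (1 - f p))) = (\<Sum>p | prime p \<and> p \<le> N. - ln (1 - f p))"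
      using f1 by (intro sum.cong) (auto simp: ln_one_over)
  qed (use f1 in \<open>auto simp: less_imp_neq\<close>)
  also have "\<dots> \<le> (\<Sum>p | prime p \<and> p \<le> N. - ln (1 - 1 / real p) * real p powr (- s))"
  proof (intro sum_mono)
    fix p assume "p \<in> {p. prime p \<and> p \<le> N}"
    then have p: "real p > 1" using prime_gt_1_nat[of p] by auto
    have "f p = real p powr (- s) * (1 / real p)"
      using p by (simp add: f_def powr_diff powr_minus divide_simps)
    moreover have "real p powr (- s) \<le> 1" using p s by (intro less_imp_le powr_less_one) auto
    ultimately show "- ln (1 - f p) \<le> - ln (1 - 1 / real p) * real p powr (- s)"
      using ln_one_minus_mult_ge[of "real p powr (- s)" "1 / real p"] p by (simp add: mult.commute)
  qed
  finally show ?thesis .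
qed

text \<open>Writing \<open>p powr (- s)\<close> as the integral of \<open>exp (- u)\<close> over \<open>u \<ge> s * ln p\<close> expresses the sum over
  primes through the logarithm of the Mertens product at \<open>exp (u / s)\<close>. The bound
  \<open>ln u \<le> (u powr d - 1) / d\<close> then replaces the integral of \<open>exp (- u) * ln u\<close>, whose value is
  \<open>- euler_mascheroni\<close>, by a difference quotient of the Gamma function at \<open>1\<close>.\<close>

lemma sum_primes_powr_le:
  fixes s c d :: real
  assumes s: "s > 0" and c: "c > 0" and d: "d > 0" and Y0: "Y0 \<ge> 2"
    and bound: "\<And>y. y \<ge> Y0 \<Longrightarrow> mertens_product y \<le> c * ln (real y)"
    and small: "ln c - ln s - 1 / d \<ge> 0"
  shows "(\<Sum>p | prime p \<and> p \<le> N. - ln (1 - 1 / real p) * real p powr (- s))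
    \<le> ln c - ln s - 1 / d + Gamma (1 + d) / d + ln (mertens_product Y0) * (s * ln (real Y0))"
proof -
  define P where "P = {p. prime p \<and> p \<le> N}"
  have finP: "finite P" by (simp add: P_def)
  define w where "w p = - ln (1 - 1 / real p)" for p :: nat
  define E where "E = ln (mertens_product Y0)"
  \<comment> \<open>L integrates to the weighted prime sum, and R is an integrable majorant of it.
    The constant E in R pays for the short range u <= s ln Y0, where \<open>bound\<close> says
    nothing; its contribution vanishes as s tends to 0.\<close>
  define L where "L u = (\<Sum>p\<in>P. w p * (if u \<in> {s * ln (real p)..} then exp (- u) else 0))" for u
  define R where "R u = (ln c - ln s - 1 / d) * exp (- u) + (u powr (1 + d - 1) / exp u) / d
    + (if u \<in> {0..s * ln (real Y0)} then E else 0)" for u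
  have w: "w p \<ge> 0" if "prime p" for p
    unfolding w_def by (rule neg_ln_prime_nonneg[OF that])
  have E: "E \<ge> 0"
    unfolding E_def ln_mertens_product by (intro sum_nonneg neg_ln_prime_nonneg) auto
  have expint: "((\<lambda>x. exp (- x)) has_integral exp (- a)) {a..}" for a :: real
    using has_integral_exp_minus_to_infinity[of 1 a] by simp
  have "(L has_integral (\<Sum>p\<in>P. w p * real p powr (- s))) {0..}"
    unfolding L_def
  proof (intro has_integral_sum has_integral_mult_right)
    show "finite P" by (rule finP)
    fix p assume "p \<in> P"
    then have p: "real p \<ge> 1" using prime_ge_1_nat[of p] by (auto simp: P_def)
    then have "real p powr (- s) = exp (- (s * ln (real p)))" by (simp add: powr_def)
    moreover have "{s * ln (real p)..} \<subseteq> {0..}" using p s by auto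
    ultimately show "((\<lambda>u. if u \<in> {s * ln (real p)..} then exp (- u) else 0) has_integral
        real p powr (- s)) {0..}"
      using expint by (simp only: has_integral_restrict)
  qed
  moreover have "(R has_integral ((ln c - ln s - 1 / d) * exp (- 0) + Gamma (1 + d) / d
      + E * (s * ln (real Y0)))) {0..}"
    unfolding R_def
  proof (intro has_integral_add has_integral_mult_right has_integral_divide expint)
    show "((\<lambda>u. u powr (1 + d - 1) / exp u) has_integral Gamma (1 + d)) {0..}"
      by (rule Gamma_integral_real) (use d in simp)
    have "{0..s * ln (real Y0)} \<subseteq> {0..}" by auto
    moreover have "((\<lambda>u. E) has_integral E * (s * ln (real Y0))) {0..s * ln (real Y0)}"
      using has_integral_const_real[of E 0 "s * ln (real Y0)"] s Y0 by (simp add: mult.commute)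
    ultimately show "((\<lambda>u. if u \<in> {0..s * ln (real Y0)} then E else 0) has_integral
        E * (s * ln (real Y0))) {0..}"
      by (simp only: has_integral_restrict)
  qed
  moreover have "L u \<le> R u" if u: "u \<in> {0..}" for u
  proof -
    \<comment> \<open>The primes with s ln p <= u are those up to exp (u / s), so L u is at most exp
      (-u) times the logarithm of the Mertens product at y.\<close>
    define y where "y = nat \<lfloor>exp (u / s)\<rfloor>"
    have "L u = exp (- u) * (\<Sum>p\<in>P. if s * ln (real p) \<le> u then w p else 0)"
      unfolding L_def sum_distrib_left by (intro sum.cong) auto
    also have "\<dots> = exp (- u) * (\<Sum>p\<in>{p\<in>P. s * ln (real p) \<le> u}. w p)"
      by (simp only: sum.inter_filter[OF finP])
    also have "\<dots> \<le> exp (- u) * (\<Sum>p | prime p \<and> p \<le> y. w p)"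
    proof (intro mult_left_mono sum_mono2)
      show "{p\<in>P. s * ln (real p) \<le> u} \<subseteq> {p. prime p \<and> p \<le> y}"
      proof
        fix p assume p: "p \<in> {p\<in>P. s * ln (real p) \<le> u}"
        then have "real p > 0" using prime_gt_0_nat[of p] by (auto simp: P_def)
        have "ln (real p) \<le> u / s" using p s by (simp add: field_simps)
        then have "exp (ln (real p)) \<le> exp (u / s)" by (simp only: exp_le_cancel_iff)
        then have "real p \<le> exp (u / s)" using \<open>real p > 0\<close> by simp
        then have "p \<le> y" unfolding y_def by (simp add: le_nat_floor)
        then show "p \<in> {p. prime p \<and> p \<le> y}" using p by (simp add: P_def)
      qed
    qed (use w in auto)
    also have "\<dots> = exp (- u) * ln (mertens_product y)"
      unfolding ln_mertens_product w_def ..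
    finally have Lu: "L u \<le> exp (- u) * ln (mertens_product y)" .
    have G: "(u powr (1 + d - 1) / exp u) / d \<ge> 0" using d by simp
    have e0: "exp (- u) \<le> 1" "exp (- u) > 0" using u by auto
    show ?thesis
    proof (cases "u \<le> s * ln (real Y0)")
      case True
      then have "u / s \<le> ln (real Y0)" using s by (simp add: field_simps)
      then have "exp (u / s) \<le> exp (ln (real Y0))" by (simp only: exp_le_cancel_iff)
      then have "exp (u / s) \<le> real Y0" using Y0 by simp
      then have "\<lfloor>exp (u / s)\<rfloor> \<le> int Y0" by (simp add: floor_le_iff)
      then have "y \<le> Y0" unfolding y_def by simp
      then have "ln (mertens_product y) \<le> E" unfolding E_def by (rule ln_mertens_product_mono)
      then have "exp (- u) * ln (mertens_product y) \<le> exp (- u) * E"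
        using e0 by (intro mult_left_mono) auto
      also have "\<dots> \<le> 1 * E" using e0 E by (intro mult_right_mono) auto
      finally have "L u \<le> E" using Lu by simp
      \<comment> \<open>Here \<open>small\<close> enters: on the short range E alone must dominate,
        so the other summands of R have to be nonnegative.\<close>
      moreover have "(ln c - ln s - 1 / d) * exp (- u) \<ge> 0" using small e0 by simp
      ultimately show ?thesis using G True u unfolding R_def by simp
    next
      case False
      have "s * ln (real Y0) \<ge> 0" using s Y0 by simp
      then have u0: "u > 0" "u / s > ln (real Y0)" using s False by (simp_all add: field_simps)
      then have "exp (ln (real Y0)) < exp (u / s)" by (simp only: exp_less_cancel_iff)
      then have "real Y0 < exp (u / s)" using Y0 by simp
      then have y: "y \<ge> Y0" unfolding y_def by (simp add: le_nat_floor)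
      have "real y \<le> exp (u / s)" unfolding y_def by simp
      then have "ln (real y) \<le> ln (exp (u / s))" using y Y0 by (intro ln_mono) auto
      then have "ln (real y) \<le> u / s" by simp
      then have "c * ln (real y) \<le> c * (u / s)" using c by (intro mult_left_mono) auto
      with bound[OF y] have le: "mertens_product y \<le> c * u / s" by simp
      have "mertens_product y > 0" unfolding mertens_product_def
      proof (intro prod_pos)
        fix p assume "p \<in> {p. prime p \<and> p \<le> y}"
        then show "0 < 1 / (1 - 1 / real p)" using prime_gt_1_nat[of p] by simp
      qed
      then have "ln (mertens_product y) \<le> ln (c * u / s)" using le by (intro ln_mono) auto
      also have "\<dots> = ln c + ln u - ln s" using c u0 s by (simp add: ln_mult ln_div)
      also have "\<dots> \<le> ln c + (u powr d - 1) / d - ln s"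
      proof -
        have "d * ln u \<le> u powr d - 1"
          using ln_le_minus_one[of "u powr d"] u0 by simp
        then show ?thesis using d by (simp add: field_simps)
      qed
      finally have "exp (- u) * ln (mertens_product y) \<le> exp (- u) * (ln c + (u powr d - 1) / d - ln s)"
        using e0 by (intro mult_left_mono) auto
      also have "\<dots> = (ln c - ln s - 1 / d) * exp (- u) + (u powr (1 + d - 1) / exp u) / d"
        using d by (simp add: exp_minus divide_inverse algebra_simps)
      finally show ?thesis using Lu False unfolding R_def by simp
    qed
  qed
  ultimately have "(\<Sum>p\<in>P. w p * real p powr (- s)) \<le> (ln c - ln s - 1 / d) * exp (- 0) + Gamma (1 + d) / d
      + E * (s * ln (real Y0))"
    by (rule has_integral_le)
  then show ?thesis unfolding P_def w_def E_def by simp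
qed

text \<open>If the Mertens product were at most c ln y from some point on, both bounds for the prime
  sum would contain -ln s, which cancels. Letting N grow, then s tend to 0, then d tend to 0, leaves
  0 <= ln c - gamma, contrary to c < e^gamma.\<close>

lemma mertens_product_unbounded_ratio:
  assumes c: "0 < c" "c < exp euler_mascheroni"
  shows "\<exists>y\<ge>Y. mertens_product y > c * ln (real y)"
proof (rule ccontr)
  assume contra: "\<not> ?thesis"
  define Y0 where "Y0 = max Y 2"
  have Y0: "Y0 \<ge> 2" by (simp add: Y0_def)
  have bound: "mertens_product y \<le> c * ln (real y)" if "y \<ge> Y0" for y
    using contra that unfolding Y0_def by (meson max.boundedE not_le)
  define E where "E = ln (mertens_product Y0) * ln (real Y0)"
  \<comment> \<open>The restriction s <= c exp (-1/d) is the hypothesis \<open>small\<close> solved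
    for s. It is the reason why d stays fixed while s tends to 0.\<close>
  have 1: "0 \<le> ln c - 1 / d + Gamma (1 + d) / d + E * s"
    if d: "d > 0" and s: "s > 0" "s \<le> c * exp (- (1 / d))" for s d
  proof -
    have "ln s \<le> ln (c * exp (- (1 / d)))" using s by (intro ln_mono) auto
    then have small: "ln c - ln s - 1 / d \<ge> 0" using c by (simp add: ln_mult)
    have "ln ((1 - (real N + 1) powr (- s)) / s) \<le> ln c - ln s - 1 / d + Gamma (1 + d) / d + E * s"
      if "N \<ge> 1" for N
      using order_trans[OF zeta_le_sum_primes[OF s(1) that]
        sum_primes_powr_le[OF s(1) c(1) d Y0 bound small, of N]]
      unfolding E_def by (simp add: mult_ac)
    moreover have "(\<lambda>N. ln ((1 - (real N + 1) powr (- s)) / s)) \<longlonglongrightarrow> ln ((1 - 0) / s)"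
    proof (intro tendsto_intros)
      have "filterlim (\<lambda>N. real (Suc N)) at_top sequentially"
        by (rule filterlim_compose[OF filterlim_real_sequentially filterlim_Suc])
      then have "filterlim (\<lambda>N. real N + 1) at_top sequentially" by (simp add: add.commute)
      then show "(\<lambda>N. (real N + 1) powr (- s)) \<longlonglongrightarrow> 0"
        using s by (intro tendsto_neg_powr) auto
    qed (use s in auto)
    ultimately have "ln ((1 - 0) / s) \<le> ln c - ln s - 1 / d + Gamma (1 + d) / d + E * s"
      by (intro LIMSEQ_le_const2) auto
    then show ?thesis using s by (simp add: ln_div)
  qed
  have 2: "0 \<le> ln c + (Gamma (1 + d) - Gamma 1) / d" if d: "d > 0" for d :: real
  proof (rule tendsto_lowerbound)
    show "((\<lambda>s. ln c - 1 / d + Gamma (1 + d) / d + E * s) \<longlongrightarrow> ln c + (Gamma (1 + d) - Gamma 1) / d)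
        (at_right 0)"
      by (auto intro!: tendsto_eq_intros simp: diff_divide_distrib)
    show "\<forall>\<^sub>F s in at_right 0. 0 \<le> ln c - 1 / d + Gamma (1 + d) / d + E * s"
      using c(1) 1[OF d] unfolding eventually_at_right_field
      by (intro exI[of _ "c * exp (- (1 / d))"]) (auto intro: less_imp_le)
  qed simp
  \<comment> \<open>Digamma 1 is -gamma and Gamma 1 is 1, so the difference quotient tends to
    -gamma.\<close>
  have "(Gamma has_field_derivative Gamma 1 * Digamma 1) (at (1 :: real))"
    by (rule has_field_derivative_Gamma) (auto elim!: nonpos_Ints_cases)
  then have "((\<lambda>d. (Gamma (1 + d) - Gamma 1) / d) \<longlongrightarrow> - euler_mascheroni) (at (0 :: real))"
    by (simp add: DERIV_def)
  then have "((\<lambda>d. (Gamma (1 + d) - Gamma 1) / d) \<longlongrightarrow> - euler_mascheroni) (at_right (0 :: real))"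
    by (rule filterlim_mono[OF _ order_refl at_le]) simp
  then have "((\<lambda>d. ln c + (Gamma (1 + d) - Gamma 1) / d) \<longlongrightarrow> ln c + - euler_mascheroni) (at_right (0 :: real))"
    by (intro tendsto_add tendsto_const)
  then have "0 \<le> ln c + - euler_mascheroni"
    by (rule tendsto_lowerbound)
      (use 2 in \<open>auto simp: eventually_at_right_field intro: exI[of _ 1]\<close>)
  then have "exp euler_mascheroni \<le> c" using c(1) by (simp add: ln_ge_iff)
  then show False using c(2) by simp
qed

section \<open>From resonance to the oscillation of the sum\<close>

text \<open>The averaged head costs a + b, and 1 more for the shifted T; the tail beyond M costs 5
  (1 + a). Together this is 6a + b + 6. The tail bound applies because M^2 = 4 A^4 exceeds T, while
  A >= a + 2 ensures M + r <= A^4 - 1.\<close>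

lemma sawtooth_sum_extremes:
  fixes a b A :: nat
  assumes b: "b > 0" and A: "A \<ge> a + 2"
  shows "\<exists>T\<ge>real A ^ 4 - 1. T \<le> 2 * real A ^ 4 \<and>
      sawtooth_sum (real a / real b) T \<le> - (resonance a b A / 2 - (6 * real a + real b + 6))"
    and "\<exists>T\<ge>real A ^ 4 - 1. T \<le> 2 * real A ^ 4 \<and>
      sawtooth_sum (real a / real b) T \<ge> resonance a b A / 2 - (6 * real a + real b + 6)"
proof -
  define r where "r = real a / real b"
  define M where "M = 2 * A ^ 2"
  have A1: "A \<ge> 1" and M: "M \<ge> 1" using A by (auto simp: M_def)
  have "real a * 1 \<le> real a * real b" using b by (intro mult_left_mono) auto
  then have r: "r \<ge> 0" "r \<le> a" using b by (auto simp: r_def field_simps)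
  have M_le: "real M + r \<le> real A ^ 4 - 1"
  proof -
    have "real a + 2 \<le> real A" using A by linarith
    then have *: "real A \<ge> 2" "real A \<ge> r + 2" using r by linarith+
    then have "real A * 2 \<le> real A * real A" "2 * 2 \<le> real A * real A"
      by (intro mult_mono mult_left_mono; simp)+
    then have 1: "real A ^ 2 \<ge> 4" "real A ^ 2 \<ge> r + 2" using * r unfolding power2_eq_square by linarith+
    then have "4 * real A ^ 2 \<le> real A ^ 2 * real A ^ 2" by (intro mult_right_mono) auto
    then show ?thesis using 1 r by (simp add: M_def flip: power_add)
  qed
  have split: "\<bar>sawtooth_sum r T - (\<Sum>m\<in>{1..M}. sawtooth (T / (real m + r)) / real m)\<bar> \<le> 5 * (1 + real a)"
    if T: "real A ^ 4 - 1 \<le> T" "T \<le> 2 * real A ^ 4" for T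
  proof -
    have MT: "real M + r \<le> T" using T M_le by linarith
    have "real M ^ 2 = 4 * real A ^ 4" by (simp add: M_def power_mult_distrib flip: power_mult)
    moreover have "real A ^ 4 \<ge> 0" by simp
    ultimately have "T \<le> real M ^ 2" using T by linarith
    with MT have "\<bar>\<Sum>m\<in>{M<..nat \<lfloor>T\<rfloor>}. sawtooth (T / (real m + r)) / real m\<bar> \<le> 5 * (1 + r)"
      by (intro sawtooth_tail_bounded r M)
    moreover have "sawtooth_sum r T = (\<Sum>m\<in>{1..M}. sawtooth (T / (real m + r)) / real m)
        + (\<Sum>m\<in>{M<..nat \<lfloor>T\<rfloor>}. sawtooth (T / (real m + r)) / real m)"
    proof -
      have "M \<le> nat \<lfloor>T\<rfloor>" using MT r by (intro le_nat_floor) linarith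
      then have "{1..nat \<lfloor>T\<rfloor>} = {1..M} \<union> {M<..nat \<lfloor>T\<rfloor>}" using M by auto
      then show ?thesis unfolding sawtooth_sum_eq by (simp add: sum.union_disjoint ivl_disj_int)
    qed
    ultimately have "\<bar>sawtooth_sum r T - (\<Sum>m\<in>{1..M}. sawtooth (T / (real m + r)) / real m)\<bar> \<le> 5 * (1 + r)"
      by simp
    also have "\<dots> \<le> 5 * (1 + real a)" using r by simp
    finally show ?thesis .
  qed
  obtain T where "real A ^ 4 \<le> T" and T: "T \<le> 2 * real A ^ 4"
    "(\<Sum>m\<in>{1..M}. sawtooth (T / (real m + r)) / real m) \<le> - resonance a b A / 2 + (real a + real b)"
    using sawtooth_average_le[OF b A1, of a] unfolding M_def r_def by blast
  moreover from this have "real A ^ 4 - 1 \<le> T" by linarith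
  ultimately show "\<exists>T\<ge>real A ^ 4 - 1. T \<le> 2 * real A ^ 4 \<and>
      sawtooth_sum (real a / real b) T \<le> - (resonance a b A / 2 - (6 * real a + real b + 6))"
    using split[of T] unfolding r_def[symmetric] by (intro exI[of _ T]) (auto simp: abs_le_iff)
  obtain T' where T': "real A ^ 4 - 1 \<le> T'" "T' \<le> 2 * real A ^ 4"
    "(\<Sum>m\<in>{1..M}. sawtooth (T' / (real m + r)) / real m) \<ge> resonance a b A / 2 - (real a + real b) - 1"
    using sawtooth_average_ge[OF b A1, of a] unfolding M_def r_def by blast
  then show "\<exists>T\<ge>real A ^ 4 - 1. T \<le> 2 * real A ^ 4 \<and>
      sawtooth_sum (real a / real b) T \<ge> resonance a b A / 2 - (6 * real a + real b + 6)"
    using split[of T'] unfolding r_def[symmetric] by (intro exI[of _ T']) (auto simp: abs_le_iff)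
qed

section \<open>Limsup and liminf from values attained for arbitrarily large T\<close>

lemma frequently_at_topI:
  fixes P :: "real \<Rightarrow> bool"
  assumes "\<And>N. \<exists>T\<ge>N. P T"
  shows "\<exists>\<^sub>F T in at_top. P T"
  unfolding frequently_def eventually_at_top_linorder using assms by blast

lemma Limsup_ge_frequently:
  fixes f :: "'a \<Rightarrow> real"
  assumes "\<And>x. x < c \<Longrightarrow> \<exists>\<^sub>F t in F. x \<le> f t"
  shows "ereal c \<le> Limsup F (\<lambda>t. ereal (f t))"
proof (rule ccontr)
  assume "\<not> ?thesis"
  then obtain x where x: "Limsup F (\<lambda>t. ereal (f t)) < ereal x" "ereal x < ereal c"
    using ereal_dense2 by (metis not_le)
  then have "\<forall>\<^sub>F t in F. ereal (f t) < ereal x" by (intro Limsup_lessD) auto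
  then have "\<not> (\<exists>\<^sub>F t in F. x \<le> f t)" by (simp add: frequently_def not_le)
  then show False using assms x by simp
qed

lemma Liminf_le_frequently:
  fixes f :: "'a \<Rightarrow> real"
  assumes "\<And>x. x < c \<Longrightarrow> \<exists>\<^sub>F t in F. f t \<le> - x"
  shows "Liminf F (\<lambda>t. ereal (f t)) \<le> ereal (- c)"
proof -
  have "ereal c \<le> Limsup F (\<lambda>t. ereal (- f t))"
    using assms by (intro Limsup_ge_frequently) (simp add: le_minus_iff)
  then have "- Limsup F (\<lambda>t. ereal (- f t)) \<le> - ereal c"
    by (simp only: ereal_minus_le_minus)
  then show ?thesis using ereal_Limsup_uminus[of F "\<lambda>t. ereal (f t)"] by simp
qed

lemma ln_ln_at_top: "filterlim (\<lambda>n::nat. ln (ln (real n))) at_top sequentially"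
  by (intro filterlim_compose[OF ln_at_top] filterlim_compose[OF ln_at_top] filterlim_real_sequentially)

text \<open>From T <= 2 A^4 follows ln T <= 5 ln A, so ln ln T exceeds ln ln A by at most ln 5. This
  and the constant C are absorbed by the gap between 2 x and \<open>\<kappa>\<close> once ln ln A is
  large.\<close>

lemma oscillation_of_resonance:
  fixes a b :: nat and \<kappa> :: real
  assumes b: "b > 0" and \<kappa>: "\<kappa> > 0"
    and res: "\<And>c N. 0 \<le> c \<Longrightarrow> c < \<kappa> \<Longrightarrow> \<exists>A\<ge>N. resonance a b A \<ge> c * ln (ln (real A))"
  shows "Limsup at_top (\<lambda>T::real. ereal (sawtooth_sum (real a / real b) T / ln (ln T))) \<ge> ereal (\<kappa> / 2)"
    and "Liminf at_top (\<lambda>T::real. ereal (sawtooth_sum (real a / real b) T / ln (ln T))) \<le> ereal (- (\<kappa> / 2))"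
proof -
  define C where "C = 6 * real a + real b + 6"
  have large: "\<exists>A\<ge>a + 2. real A ^ 4 - 1 \<ge> T0 \<and>
      (\<forall>T\<ge>real A ^ 4 - 1. T \<le> 2 * real A ^ 4 \<longrightarrow>
        ln (ln T) > 0 \<and> x * ln (ln T) \<le> resonance a b A / 2 - C)"
    if x: "x < \<kappa> / 2" for x T0
  proof -
    \<comment> \<open>A nonnegative factor is needed to multiply upper bounds for ln ln T; x itself
      may be negative.\<close>
    define y where "y = max x 0"
    have y: "y \<ge> 0" "x \<le> y" "2 * y < \<kappa>" using x \<kappa> by (auto simp: y_def)
    then obtain c where c: "2 * y < c" "c < \<kappa>" using dense by blast
    \<comment> \<open>The threshold is the inequality y (ln 5 + ln ln A) <= (c/2) ln ln A - C solved
      for ln ln A.\<close>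
    have "\<forall>\<^sub>F A in sequentially. ln (ln (real A)) \<ge> (C + y * ln 5) / (c / 2 - y)"
      using ln_ln_at_top by (simp add: filterlim_at_top)
    moreover have "\<forall>\<^sub>F A in sequentially. real A \<ge> max T0 0 + 3"
      using filterlim_real_sequentially by (simp add: filterlim_at_top)
    ultimately have "\<forall>\<^sub>F A in sequentially. ln (ln (real A)) \<ge> (C + y * ln 5) / (c / 2 - y)
        \<and> real A \<ge> max T0 0 + 3 \<and> A \<ge> a + 2"
      using eventually_ge_at_top[of "a + 2"] by eventually_elim auto
    then obtain N where N: "\<And>A. A \<ge> N \<Longrightarrow> ln (ln (real A)) \<ge> (C + y * ln 5) / (c / 2 - y)
        \<and> real A \<ge> max T0 0 + 3 \<and> A \<ge> a + 2"
      by (auto simp: eventually_sequentially)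
    obtain A where "A \<ge> N" and D: "resonance a b A \<ge> c * ln (ln (real A))"
      using res[of c N] c y by auto
    with N have A: "ln (ln (real A)) \<ge> (C + y * ln 5) / (c / 2 - y)"
      "real A \<ge> 3" "real A \<ge> T0 + 3" "A \<ge> a + 2" by force+
    have "real A * 1 \<le> real A * real A ^ 3" using A by (intro mult_left_mono one_le_power) auto
    then have A4: "real A ^ 4 \<ge> real A" by (simp add: eval_nat_numeral)
    have "real A ^ 4 \<ge> 3 ^ 4" using A by (intro power_mono) auto
    then have A4': "real A ^ 4 \<ge> 81" by simp
    have "ln (ln T) > 0 \<and> x * ln (ln T) \<le> resonance a b A / 2 - C"
      if T: "T \<ge> real A ^ 4 - 1" "T \<le> 2 * real A ^ 4" for T
    proof -
      have "exp 1 < T" using exp_le T A4' by linarith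
      then have "ln (exp 1) < ln T" using T A4' by (subst ln_less_cancel_iff) auto
      then have lnT: "ln T > 1" by simp
      have "ln T \<le> ln (2 * real A ^ 4)" using T A4' by (intro ln_mono) auto
      also have "\<dots> = ln 2 + 4 * ln (real A)" using A by (simp add: ln_mult ln_realpow)
      also have "\<dots> \<le> 5 * ln (real A)" using A by simp
      finally have "ln (ln T) \<le> ln (5 * ln (real A))" using lnT by (intro ln_mono) auto
      also have "\<dots> = ln 5 + ln (ln (real A))" using A by (simp add: ln_mult)
      finally have le: "ln (ln T) \<le> ln 5 + ln (ln (real A))" .
      have pos: "ln (ln T) > 0" using lnT by simp
      have "x * ln (ln T) \<le> y * ln (ln T)" using y pos by (intro mult_right_mono) auto
      also have "\<dots> \<le> y * (ln 5 + ln (ln (real A)))" using le y by (intro mult_left_mono)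
      also have "\<dots> \<le> c / 2 * ln (ln (real A)) - C"
        using A(1) c by (simp add: field_simps)
      also have "\<dots> \<le> resonance a b A / 2 - C" using D by simp
      finally show ?thesis using pos by simp
    qed
    moreover have "real A ^ 4 - 1 \<ge> T0" using A A4 by linarith
    ultimately show ?thesis using A(4) by blast
  qed
  show "Limsup at_top (\<lambda>T::real. ereal (sawtooth_sum (real a / real b) T / ln (ln T))) \<ge> ereal (\<kappa> / 2)"
  proof (intro Limsup_ge_frequently frequently_at_topI)
    fix x T0 :: real assume "x < \<kappa> / 2"
    from large[OF this, of T0] obtain A where A: "A \<ge> a + 2" "real A ^ 4 - 1 \<ge> T0"
      "\<And>T. T \<ge> real A ^ 4 - 1 \<Longrightarrow> T \<le> 2 * real A ^ 4 \<Longrightarrow>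
        ln (ln T) > 0 \<and> x * ln (ln T) \<le> resonance a b A / 2 - C" by blast
    obtain T where T: "T \<ge> real A ^ 4 - 1" "T \<le> 2 * real A ^ 4"
      "sawtooth_sum (real a / real b) T \<ge> resonance a b A / 2 - C"
      using sawtooth_sum_extremes(2)[OF b A(1)] unfolding C_def by blast
    then show "\<exists>T\<ge>T0. x \<le> sawtooth_sum (real a / real b) T / ln (ln T)"
      using A(2) A(3)[OF T(1,2)] by (intro exI[of _ T]) (auto simp: pos_le_divide_eq)
  qed
  show "Liminf at_top (\<lambda>T::real. ereal (sawtooth_sum (real a / real b) T / ln (ln T))) \<le> ereal (- (\<kappa> / 2))"
  proof (intro Liminf_le_frequently frequently_at_topI)
    fix x T0 :: real assume "x < \<kappa> / 2"
    from large[OF this, of T0] obtain A where A: "A \<ge> a + 2" "real A ^ 4 - 1 \<ge> T0"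
      "\<And>T. T \<ge> real A ^ 4 - 1 \<Longrightarrow> T \<le> 2 * real A ^ 4 \<Longrightarrow>
        ln (ln T) > 0 \<and> x * ln (ln T) \<le> resonance a b A / 2 - C" by blast
    obtain T where T: "T \<ge> real A ^ 4 - 1" "T \<le> 2 * real A ^ 4"
      "sawtooth_sum (real a / real b) T \<le> - (resonance a b A / 2 - C)"
      using sawtooth_sum_extremes(1)[OF b A(1)] unfolding C_def by blast
    then show "\<exists>T\<ge>T0. sawtooth_sum (real a / real b) T / ln (ln T) \<le> - x"
      using A(2) A(3)[OF T(1,2)] by (intro exI[of _ T]) (auto simp: pos_divide_le_eq)
  qed
qed

section \<open>Lower bounds for the resonance sum\<close>

text \<open>The left side is c times the upper bound for ln ln A, the right side the lower bound for
  the resonance sum. After division by ln y they tend to c and \<open>\<kappa>\<close>.\<close>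

lemma eventually_linear_beats_ln:
  fixes c \<kappa> B1 B2 :: real
  assumes "c < \<kappa>"
  shows "\<forall>\<^sub>F y in sequentially.
    c * (ln (real y) + ln (ln (real y)) + B2) \<le> \<kappa> * ln (real y) - B1"
proof -
  define g where "g x = \<kappa> - B1 / x - c * (1 + ln x / x + B2 / x)" for x :: real
  have inv: "((\<lambda>x. B / x) \<longlongrightarrow> 0) at_top" for B :: real
    by (intro tendsto_divide_0[OF tendsto_const] filterlim_at_top_imp_at_infinity filterlim_ident)
  have "(g \<longlongrightarrow> \<kappa> - 0 - c * (1 + 0 + 0)) at_top"
    unfolding g_def by (intro tendsto_intros inv ln_x_over_x_tendsto_0)
  then have "\<forall>\<^sub>F x in at_top. g x > 0" using assms by (intro order_tendstoD) auto
  moreover have "\<forall>\<^sub>F x :: real in at_top. x > 0" by (rule eventually_gt_at_top)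
  ultimately have "\<forall>\<^sub>F x in at_top. c * (x + ln x + B2) \<le> \<kappa> * x - B1"
  proof eventually_elim
    case (elim x)
    then have "x * g x \<ge> 0" by simp
    moreover have "x * g x = \<kappa> * x - B1 - c * (x + ln x + B2)"
      using elim by (simp add: g_def field_simps)
    ultimately show ?case by simp
  qed
  moreover have "filterlim (\<lambda>y::nat. ln (real y)) at_top sequentially"
    by (intro filterlim_compose[OF ln_at_top] filterlim_real_sequentially)
  ultimately show ?thesis by (rule eventually_compose_filterlim)
qed

text \<open>Every b m + a up to y divides y!, so a full harmonic sum up to (y - a) div b is
  available. The hypothesis gives y - a >= y/2, the source of the 2 in ln (2 b).\<close>

lemma resonance_fact_ge:
  assumes b: "b > 0" and y: "y \<ge> 2 * a + 2"
  shows "resonance a b (fact y) \<ge> ln (real y) - ln (2 * real b)"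
proof -
  define K where "K = (y - a) div b"
  have "y - a < b * (K + 1)" unfolding K_def using b dividend_less_times_div[of b "y - a"] by simp
  then have "real (y - a) \<le> real (b * (K + 1))" by linarith
  then have "real y - real a \<le> real b * (real K + 1)" using y by (simp add: of_nat_diff algebra_simps)
  moreover have "real y \<ge> 2 * real a" using y by linarith
  ultimately have "real y / (2 * real b) \<le> real K + 1" using b by (simp add: field_simps)
  then have "ln (real y / (2 * real b)) \<le> ln (real K + 1)" using b y by (intro ln_mono) auto
  then have "ln (real y) - ln (2 * real b) \<le> ln (real K + 1)" using b y by (simp add: ln_div)
  also have "\<dots> \<le> (\<Sum>m\<in>{1..K}. 1 / real m)"
    using ln_le_harm[of K] by (simp add: harm_def inverse_eq_divide)
  also have "\<dots> \<le> resonance a b (fact y)"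
    unfolding resonance_def
  proof (intro sum_mono2)
    show "{1..K} \<subseteq> {m\<in>{1..2 * fact y ^ 2}. (b * m + a) dvd b * fact y}"
    proof
      fix m assume m: "m \<in> {1..K}"
      have "b * m \<le> b * K" using m by simp
      also have "b * K \<le> y - a" by (simp add: K_def)
      finally have le: "b * m + a \<le> y" using y by simp
      have "m \<le> b * m" using b by simp
      moreover have "1 \<le> m" using m by simp
      ultimately have "1 \<le> b * m + a" "m \<le> y" using le by linarith+
      note \<open>m \<le> y\<close>
      also have "y \<le> fact y" by (rule fact_ge_self)
      also have "\<dots> \<le> 2 * fact y ^ 2" by (simp add: power2_eq_square)
      finally have "m \<le> 2 * fact y ^ 2" .
      moreover have "(b * m + a) dvd fact y" using \<open>1 \<le> b * m + a\<close> le by (rule dvd_fact)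
      ultimately show "m \<in> {m\<in>{1..2 * fact y ^ 2}. (b * m + a) dvd b * fact y}"
        using m by auto
    qed
  qed auto
  finally show ?thesis .
qed

lemma ln_ln_le:
  fixes A k y :: nat
  assumes "A \<ge> 2" "k \<ge> 1" "y \<ge> 2" "ln (real A) \<le> real k * (real y * ln (real y))"
  shows "ln (ln (real A)) \<le> ln (real y) + ln (ln (real y)) + ln (real k)"
proof -
  have "ln (ln (real A)) \<le> ln (real k * (real y * ln (real y)))"
    using assms by (intro ln_mono) auto
  also have "\<dots> = ln (real y) + ln (ln (real y)) + ln (real k)"
    using assms by (simp add: ln_mult)
  finally show ?thesis .
qed

lemma resonance_rational:
  fixes c :: real
  assumes b: "b > 0" and c: "0 \<le> c" "c < 1"
  shows "\<exists>A\<ge>N. resonance a b A \<ge> c * ln (ln (real A))"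
proof -
  have "\<forall>\<^sub>F y in sequentially.
    c * (ln (real y) + ln (ln (real y)) + 0) \<le> 1 * ln (real y) - ln (2 * real b)"
    using c by (intro eventually_linear_beats_ln)
  moreover have "\<forall>\<^sub>F y in sequentially. y \<ge> N + 2 * a + 2" by (rule eventually_ge_at_top)
  ultimately have "\<forall>\<^sub>F y in sequentially.
    c * (ln (real y) + ln (ln (real y))) \<le> ln (real y) - ln (2 * real b) \<and> y \<ge> N + 2 * a + 2"
    by eventually_elim simp
  then obtain y where y: "c * (ln (real y) + ln (ln (real y))) \<le> ln (real y) - ln (2 * real b)"
    "y \<ge> N + 2 * a + 2"
    using eventually_happens'[OF sequentially_bot] by blast
  have le: "y \<le> fact y" by (rule fact_ge_self)
  have "real (fact y) \<le> real y ^ y" using fact_le_power[of y, where 'a = real] by simp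
  then have "ln (real (fact y)) \<le> ln (real y ^ y)" by (intro ln_mono) auto
  then have "ln (real (fact y)) \<le> real 1 * (real y * ln (real y))"
    using y by (simp add: ln_realpow)
  then have "ln (ln (real (fact y))) \<le> ln (real y) + ln (ln (real y)) + ln (real 1)"
    using y le by (intro ln_ln_le) auto
  then have "c * ln (ln (real (fact y))) \<le> c * (ln (real y) + ln (ln (real y)))"
    using c by (intro mult_left_mono) auto
  also have "\<dots> \<le> ln (real y) - ln (2 * real b)" by (rule y)
  also have "\<dots> \<le> resonance a b (fact y)" using y by (intro resonance_fact_ge b) auto
  finally show ?thesis using y le by (intro exI[of _ "fact y"]) auto
qed

text \<open>Put q = b m + a; then 1/m = b/(q - a) >= b/q. The divisors q <= a correspond to no
  admissible m; their reciprocals sum to at most a, hence the loss a b.\<close>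

lemma resonance_ge_sum_divisors:
  assumes b: "b > 0" and A: "A > 0"
    and cong: "\<And>q. q dvd A \<Longrightarrow> q > a \<Longrightarrow> b dvd q - a"
  shows "resonance a b A \<ge> real b * (\<Sum>q | q dvd A. 1 / real q) - real a * real b"
proof -
  define Q where "Q = {q. q dvd A \<and> q > a}"
  define g where "g q = (q - a) div b" for q
  have finQ: "finite Q" using A by (auto simp: Q_def)
  have g: "b * g q + a = q" if "q \<in> Q" for q
    using that cong[of q] unfolding Q_def g_def by auto
  have gpos: "g q \<ge> 1" if "q \<in> Q" for q
    using g[OF that] that unfolding Q_def by (cases "g q") auto
  have inj: "inj_on g Q" by (metis g inj_onI)
  have "(\<Sum>q | q dvd A. 1 / real q) \<le> (\<Sum>q\<in>Q \<union> {1..a}. 1 / real q)"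
    using A finQ by (intro sum_mono2) (auto simp: Q_def Suc_le_eq intro: Nat.gr0I)
  also have "\<dots> = (\<Sum>q\<in>Q. 1 / real q) + (\<Sum>q\<in>{1..a}. 1 / real q)"
    using finQ by (intro sum.union_disjoint) (auto simp: Q_def)
  also have "(\<Sum>q\<in>{1..a}. 1 / real q) \<le> (\<Sum>q\<in>{1..a}. 1)"
    by (intro sum_mono) simp
  finally have "(\<Sum>q | q dvd A. 1 / real q) - real a \<le> (\<Sum>q\<in>Q. 1 / real q)" by simp
  then have "real b * ((\<Sum>q | q dvd A. 1 / real q) - real a) \<le> real b * (\<Sum>q\<in>Q. 1 / real q)"
    by (intro mult_left_mono) auto
  also have "\<dots> = (\<Sum>q\<in>Q. real b / real q)" by (simp add: sum_distrib_left)
  also have "\<dots> \<le> (\<Sum>q\<in>Q. 1 / real (g q))"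
  proof (intro sum_mono)
    fix q assume q: "q \<in> Q"
    have "real b * real (g q) + real a = real q"
      using g[OF q] by (metis of_nat_add of_nat_mult)
    then show "real b / real q \<le> 1 / real (g q)"
      using gpos[OF q] q by (simp add: Q_def divide_simps)
  qed
  also have "\<dots> = (\<Sum>m\<in>g ` Q. 1 / real m)" by (simp add: sum.reindex[OF inj])
  also have "\<dots> \<le> resonance a b A"
    unfolding resonance_def
  proof (intro sum_mono2)
    show "g ` Q \<subseteq> {m\<in>{1..2 * A ^ 2}. (b * m + a) dvd b * A}"
    proof clarify
      fix q assume q: "q \<in> Q"
      have "1 * g q \<le> b * g q" using b by (intro mult_right_mono) auto
      then have "g q \<le> q" using g[OF q] by linarith
      also have "q \<le> A" using q A by (intro dvd_imp_le) (auto simp: Q_def)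
      also have "A \<le> 2 * A ^ 2" by (simp add: power2_eq_square)
      finally show "g q \<in> {1..2 * A ^ 2} \<and> (b * g q + a) dvd b * A"
        using gpos[OF q] g[OF q] q by (simp add: Q_def)
    qed
  qed auto
  finally show ?thesis by (simp add: algebra_simps)
qed

text \<open>Cutting the geometric series at k multiplies the factor at p by 1 - p^(-k-1). The
  product of these is at least one minus the sum of p^(-k-1), and p^(-k-1) <= (2/2^k) p^(-2). The
  loss is uniform in S, so k can be fixed before y grows.\<close>

lemma sum_divisors_smooth_ge:
  fixes S :: "nat set"
  assumes S: "finite S" "\<And>p. p \<in> S \<Longrightarrow> prime p" and k: "k \<ge> 1"
  shows "(\<Sum>q | q dvd (\<Prod>p\<in>S. p ^ k). 1 / real q)
    \<ge> (1 - 4 / 2 ^ k) * (\<Prod>p\<in>S. 1 / (1 - 1 / real p))"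
proof -
  have p2: "real p \<ge> 2" if "p \<in> S" for p
    using prime_ge_2_nat[OF S(2)[OF that]] by simp
  define x where "x p = (1 / real p) ^ Suc k" for p :: nat
  have x: "0 \<le> x p" "x p \<le> 1" "x p \<le> 2 / 2 ^ k * (1 / real p ^ 2)" if "p \<in> S" for p
  proof -
    show "0 \<le> x p" by (simp add: x_def)
    show "x p \<le> 1" unfolding x_def using p2[OF that] by (intro power_le_one) auto
    obtain j where j: "k = Suc j" using k by (cases k) auto
    have "x p = (1 / real p) ^ j * (1 / real p ^ 2)"
      by (simp add: x_def j power2_eq_square power_divide)
    also have "\<dots> \<le> (1 / 2) ^ j * (1 / real p ^ 2)"
      using p2[OF that] by (intro mult_right_mono power_mono divide_left_mono) auto
    finally show "x p \<le> 2 / 2 ^ k * (1 / real p ^ 2)" by (simp add: j power_divide)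
  qed
  have "(\<Sum>p\<in>S. x p) \<le> (\<Sum>p\<in>S. 2 / 2 ^ k * (1 / real p ^ 2))"
    using x by (intro sum_mono)
  also have "\<dots> = 2 / 2 ^ k * (\<Sum>p\<in>S. 1 / real p ^ 2)" by (simp only: sum_distrib_left)
  also have "\<dots> \<le> 2 / 2 ^ k * (\<Sum>p\<in>{1..Max (insert 0 S)}. 1 / real p ^ 2)"
    using S by (intro mult_left_mono sum_mono2) (auto simp: Suc_le_eq prime_gt_0_nat)
  also have "\<dots> \<le> 2 / 2 ^ k * 2" by (intro mult_left_mono sum_inverse_squares_le) auto
  finally have "1 - 4 / 2 ^ k \<le> 1 - (\<Sum>p\<in>S. x p)" by simp
  also have "\<dots> \<le> (\<Prod>p\<in>S. 1 - x p)"
    using x by (intro Weierstrass_prod_ineq) auto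
  finally have "(1 - 4 / 2 ^ k) * (\<Prod>p\<in>S. 1 / (1 - 1 / real p))
      \<le> (\<Prod>p\<in>S. 1 - x p) * (\<Prod>p\<in>S. 1 / (1 - 1 / real p))"
  proof (intro mult_right_mono prod_nonneg)
    fix p assume "p \<in> S"
    then show "0 \<le> 1 / (1 - 1 / real p)" using p2[of p] by simp
  qed
  also have "\<dots> = (\<Prod>p\<in>S. \<Sum>j\<le>k. (1 / real p) ^ j)"
    unfolding prod.distrib[symmetric]
  proof (intro prod.cong refl)
    fix p assume "p \<in> S"
    then have "1 / real p \<noteq> 1" using p2[of p] by auto
    then show "(1 - x p) * (1 / (1 - 1 / real p)) = (\<Sum>j\<le>k. (1 / real p) ^ j)"
      by (simp only: sum_gp0 x_def if_False) simp
  qed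
  also have "\<dots> = (\<Sum>q | q dvd (\<Prod>p\<in>S. p ^ k). 1 / real q)"
    by (rule sum_divisors_prod_prime_powers[symmetric]) (use S in auto)
  finally show ?thesis .
qed

definition coprime_primes :: "nat \<Rightarrow> nat \<Rightarrow> nat set" where
  "coprime_primes b y = {p. prime p \<and> p \<le> y \<and> \<not> p dvd b}"

text \<open>For b = 2 the Euler factor removed is 1/(1 - 1/2) = 2 = b, exactly the factor gained in
  passing from 1/m to b/q.\<close>

lemma mertens_product_le_coprime:
  assumes b: "b = 1 \<or> b = 2"
  shows "mertens_product y \<le> real b * (\<Prod>p\<in>coprime_primes b y. 1 / (1 - 1 / real p))"
proof -
  have fin: "finite (coprime_primes b y)" unfolding coprime_primes_def by simp
  have ge1: "1 / (1 - 1 / real p) \<ge> 1" if "prime p" for p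
    using prime_gt_1_nat[OF that] by (simp add: divide_simps)
  show ?thesis
  proof (cases "b = 1")
    case True
    then have "coprime_primes b y = {p. prime p \<and> p \<le> y}"
      by (auto simp: coprime_primes_def)
    then show ?thesis using True by (simp add: mertens_product_def)
  next
    case False
    with b have b2: "b = 2" by simp
    have "prime p \<Longrightarrow> p dvd 2 \<Longrightarrow> p = 2" for p :: nat by (intro primes_dvd_imp_eq) auto
    \<comment> \<open>An inclusion only, since 2 is not among the primes up to y when y < 2.\<close>
    then have sub: "{p. prime p \<and> p \<le> y} \<subseteq> insert 2 (coprime_primes b y)"
      by (auto simp: coprime_primes_def b2)
    have "mertens_product y \<le> (\<Prod>p\<in>insert 2 (coprime_primes b y). 1 / (1 - 1 / real p))"
      unfolding mertens_product_def
    proof (rule prod_mono2)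
      fix p assume "p \<in> insert 2 (coprime_primes b y) - {p. prime p \<and> p \<le> y}"
      then have "prime p" by (auto simp: coprime_primes_def)
      then show "1 \<le> 1 / (1 - 1 / real p)" by (rule ge1)
    next
      fix p assume "p \<in> {p. prime p \<and> p \<le> y}"
      then have "1 \<le> 1 / (1 - 1 / real p)" by (intro ge1) auto
      then show "0 \<le> 1 / (1 - 1 / real p)" by (rule order_trans[OF zero_le_one])
    qed (use fin sub in auto)
    also have "\<dots> = 2 * (\<Prod>p\<in>coprime_primes b y. 1 / (1 - 1 / real p))"
      using fin by (subst prod.insert) (auto simp: coprime_primes_def b2)
    finally show ?thesis by (simp add: b2)
  qed
qed

lemma resonance_half_integer:
  fixes c :: real
  assumes b: "b = 1 \<or> b = 2 \<and> odd a" and c: "0 \<le> c" "c < exp euler_mascheroni"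
  shows "\<exists>A\<ge>N. resonance a b A \<ge> c * ln (ln (real A))"
proof -
  have b12: "b = 1 \<or> b = 2" and b0: "b > 0" using b by auto
  \<comment> \<open>Two slacks are spent: c1 < e^gamma on Mertens' theorem and k on the truncated
    Euler factors. Taking k >= 2 makes 1 - 4/2^k nonnegative.\<close>
  obtain c1 where c1: "c < c1" "c1 < exp euler_mascheroni" using c dense by blast
  have "(\<lambda>k. (1 - 4 * (1 / 2) ^ k) * c1) \<longlonglongrightarrow> (1 - 4 * 0) * c1"
    by (intro tendsto_intros LIMSEQ_realpow_zero) auto
  then have "\<forall>\<^sub>F k in sequentially. c < (1 - 4 * (1 / 2) ^ k) * c1"
    using c1 by (intro order_tendstoD) auto
  moreover have "\<forall>\<^sub>F k in sequentially. k \<ge> (2::nat)" by (rule eventually_ge_at_top)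
  ultimately have "\<forall>\<^sub>F k in sequentially. c < (1 - 4 * (1 / 2) ^ k) * c1 \<and> k \<ge> 2"
    by eventually_elim simp
  then obtain k where "c < (1 - 4 * (1 / 2) ^ k) * c1" and k: "k \<ge> 2"
    using eventually_happens'[OF sequentially_bot] by blast
  then have ck: "c < (1 - 4 / 2 ^ k) * c1" by (simp add: power_divide)
  have "\<forall>\<^sub>F y in sequentially. c * (ln (real y) + ln (ln (real y)) + ln (real k))
      \<le> (1 - 4 / 2 ^ k) * c1 * ln (real y) - real a * real b"
    by (rule eventually_linear_beats_ln[OF ck])
  then obtain Y where Y: "\<And>y. y \<ge> Y \<Longrightarrow> c * (ln (real y) + ln (ln (real y)) + ln (real k))
      \<le> (1 - 4 / 2 ^ k) * c1 * ln (real y) - real a * real b"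
    by (auto simp: eventually_sequentially)
  \<comment> \<open>A large prime p up to y that does not divide b must divide A, which forces A >=
    N.\<close>
  obtain p where p: "prime p" "p > N + b + 2" using bigger_prime by blast
  obtain y where y: "y \<ge> max Y p" "mertens_product y > c1 * ln (real y)"
    using mertens_product_unbounded_ratio[of c1 "max Y p"] c c1 by auto
  define S where "S = coprime_primes b y"
  define A where "A = (\<Prod>p\<in>S. p ^ k)"
  have S: "finite S" "\<And>q. q \<in> S \<Longrightarrow> prime q" unfolding S_def coprime_primes_def by auto
  have A0: "A > 0" unfolding A_def using S by (intro prod_pos) (auto simp: prime_gt_0_nat)
  have "\<not> p dvd b" using p b0 by (auto dest: dvd_imp_le)
  then have pS: "p \<in> S" using p y unfolding S_def coprime_primes_def by auto
  have "p dvd A"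
    unfolding A_def using pS S k by (intro dvd_prodI[THEN dvd_trans[rotated]]) auto
  then have "p \<le> A" using A0 by (rule dvd_imp_le)
  then have A: "A \<ge> N" "A \<ge> 2" using p by auto
  have y2: "y \<ge> 2" using y p by auto
  \<comment> \<open>The trivial count of primes is enough: it costs only a term ln ln y in ln ln
    A.\<close>
  have "real (card S) \<le> real y"
  proof -
    have "S \<subseteq> {1..y}" unfolding S_def coprime_primes_def by (auto simp: Suc_le_eq prime_gt_0_nat)
    then have "card S \<le> card {1..y}" by (intro card_mono) auto
    then show ?thesis by simp
  qed
  have "ln (real A) = (\<Sum>p\<in>S. real k * ln (real p))"
  proof -
    have "ln (real A) = ln (\<Prod>p\<in>S. real p ^ k)" by (simp add: A_def)
    also have "\<dots> = (\<Sum>p\<in>S. ln (real p ^ k))"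
      using S by (intro ln_prod) (auto simp: prime_gt_0_nat)
    finally show ?thesis by (simp add: ln_realpow)
  qed
  also have "\<dots> \<le> (\<Sum>p\<in>S. real k * ln (real y))"
  proof (intro sum_mono mult_left_mono ln_mono)
    fix q assume "q \<in> S"
    then show "0 < real q" "real q \<le> real y"
      using prime_gt_0_nat[of q] by (auto simp: S_def coprime_primes_def)
  qed auto
  also have "\<dots> = real k * (real (card S) * ln (real y))" by simp
  also have "\<dots> \<le> real k * (real y * ln (real y))"
    using \<open>real (card S) \<le> real y\<close> y2 by (intro mult_left_mono mult_right_mono) auto
  finally have "ln (ln (real A)) \<le> ln (real y) + ln (ln (real y)) + ln (real k)"
    using A y2 k by (intro ln_ln_le) auto
  then have "c * ln (ln (real A)) \<le> c * (ln (real y) + ln (ln (real y)) + ln (real k))"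
    using c by (intro mult_left_mono)
  also have "\<dots> \<le> (1 - 4 / 2 ^ k) * c1 * ln (real y) - real a * real b"
    using y by (intro Y) auto
  also have "\<dots> \<le> (1 - 4 / 2 ^ k) * mertens_product y - real a * real b"
  proof -
    have "(2::real) ^ 2 \<le> 2 ^ k" using k by (intro power_increasing) auto
    then have nonneg: "0 \<le> 1 - 4 / (2::real) ^ k" by simp
    then show ?thesis using y(2) by (simp add: mult.assoc mult_left_mono)
  qed
  also have "\<dots> \<le> (1 - 4 / 2 ^ k) * (real b * (\<Prod>p\<in>S. 1 / (1 - 1 / real p))) - real a * real b"
  proof -
    have "(2::real) ^ 2 \<le> 2 ^ k" using k by (intro power_increasing) auto
    then have "0 \<le> 1 - 4 / (2::real) ^ k" by simp
    then show ?thesis unfolding S_def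
      by (intro diff_right_mono mult_left_mono mertens_product_le_coprime b12)
  qed
  also have "\<dots> = real b * ((1 - 4 / 2 ^ k) * (\<Prod>p\<in>S. 1 / (1 - 1 / real p))) - real a * real b"
    by simp
  also have "\<dots> \<le> real b * (\<Sum>q | q dvd A. 1 / real q) - real a * real b"
    unfolding A_def using S k by (intro diff_right_mono mult_left_mono sum_divisors_smooth_ge) auto
  also have "\<dots> \<le> resonance a b A"
  proof (rule resonance_ge_sum_divisors[OF b0 A0])
    fix q assume q: "q dvd A" "q > a"
    show "b dvd q - a"
    \<comment> \<open>For b = 2 every divisor q of the odd number A is odd, as is a, so q - a is
      even.\<close>
    proof (cases "b = 1")
      case False
      with b have b2: "b = 2" "odd a" by auto
      have "odd A"
      proof
        assume "even A"
        then obtain p where "p \<in> S" "even (p ^ k)" using S by (auto simp: A_def even_prod_iff)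
        then have "prime p" "even p" "\<not> p dvd 2" by (auto simp: S_def coprime_primes_def b2)
        then show False using primes_dvd_imp_eq[OF two_is_prime_nat, of p] by simp
      qed
      then have "odd q" using q by (metis dvd_trans)
      then show ?thesis using b2 q by (simp add: even_diff_nat)
    qed simp
  qed
  finally show ?thesis using A by blast
qed

theorem theorem4p1:
  fixes r :: real
  assumes "r \<in> \<rat>" and "r \<ge> 0"
  shows "(Limsup at_top (\<lambda>T::real. ereal (sawtooth_sum r T / ln (ln T))) \<ge> ereal (1 / 2)
          \<and> Liminf at_top (\<lambda>T::real. ereal (sawtooth_sum r T / ln (ln T))) \<le> ereal (- (1 / 2)))
       \<and> (2 * r \<in> \<int> \<longrightarrow>
            Limsup at_top (\<lambda>T::real. ereal (sawtooth_sum r T / ln (ln T))) \<ge> ereal (exp euler_mascheroni / 2)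
          \<and> Liminf at_top (\<lambda>T::real. ereal (sawtooth_sum r T / ln (ln T))) \<le> ereal (- (exp euler_mascheroni / 2)))"
proof (intro conjI impI)
  obtain a b :: nat where b: "b > 0" and r: "r = real a / real b"
    using Rats_abs_nat_div_natE[OF assms(1)] assms(2) by (metis abs_of_nonneg gr0I)
  show "Limsup at_top (\<lambda>T::real. ereal (sawtooth_sum r T / ln (ln T))) \<ge> ereal (1 / 2)"
    "Liminf at_top (\<lambda>T::real. ereal (sawtooth_sum r T / ln (ln T))) \<le> ereal (- (1 / 2))"
    unfolding r using oscillation_of_resonance[OF b zero_less_one resonance_rational[OF b]] by auto
next
  assume "2 * r \<in> \<int>"
  then obtain i where i: "2 * r = of_int i" by (auto elim: Ints_cases)
  define n where "n = nat i"
  have n: "2 * r = real n" using i assms(2) unfolding n_def by simp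
  \<comment> \<open>The fraction n/2 is reduced by hand, so that denominator 2 comes with an odd
    numerator.\<close>
  obtain a b :: nat where b: "b = 1 \<or> b = 2 \<and> odd a" and r: "r = real a / real b"
  proof (cases "even n")
    case True
    then obtain m where "n = 2 * m" by (auto elim: evenE)
    then show ?thesis using n that[of 1 m] by simp
  next
    case False
    then show ?thesis using n that[of 2 n] by simp
  qed
  have b0: "b > 0" using b by auto
  show "Limsup at_top (\<lambda>T::real. ereal (sawtooth_sum r T / ln (ln T))) \<ge> ereal (exp euler_mascheroni / 2)"
    "Liminf at_top (\<lambda>T::real. ereal (sawtooth_sum r T / ln (ln T))) \<le> ereal (- (exp euler_mascheroni / 2))"
    unfolding r using oscillation_of_resonance[OF b0 exp_gt_zero resonance_half_integer[OF b]] by auto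
qed

end
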